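(* Let $\alpha\in[1,2]$ and $\beta\in[0,1]$. Then the Tsallis relative operator $(\alpha,\beta)$-entropy $$T_{\alpha,\beta}(A|B)=A^{\frac{\beta}{2}}\ln_{\alpha}\big(A^{-\frac{\beta}{2}}BA^{-\frac{\beta}{2}}\big)A^{\frac{\beta}{2}}$$ is jointly convex in the pair $(A,B)$ of strictly positive operators.
   Context: Operators are bounded linear operators on an infinite-dimensional separable Hilbert space $\mathcal H$. An operator is strictly positive if it is positive and invertible. For $\lambda\neq0$, $\ln_\lambda X:=\frac{X^\lambda-1}{\lambda}$, where $1$ is the identity operator and powers are defined by functional calculus. A function $g(A,B)$ of two strictly positive operator variables with self-adjoint values is jointly convex if $g(cA_1+(1-c)A_2,cB_1+(1-c)B_2)\le cg(A_1,B_1)+(1-c)g(A_2,B_2)$ for all strictly positive $A_1,A_2,B_1,B_2$ and all $c\in[0,1]$. *)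

theory Defs
  imports
    "HOL-Analysis.Analysis"
    "HOL-Computational_Algebra.Polynomial"
begin

section \<open>Complex Hilbert spaces\<close>

text \<open>
  A complex Hilbert space is also a real Hilbert space for the inner product
  \<open>Re \<langle>x,y\<rangle>\<close>, which induces the same norm. Building on \<^class>\<open>real_inner\<close> makes the library's
  norm, metric and topology available; positive definiteness of \<open>cinner\<close> and
  \<open>norm x = sqrt \<langle>x,x\<rangle>\<close> follow from \<open>inner_eq_Re_cinner\<close> and \<open>cinner_commute\<close>.
  The form is linear in its second argument.
\<close>

class complex_hilbert_space = real_inner + banach +
  fixes scaleC :: "complex \<Rightarrow> 'a \<Rightarrow> 'a"  (infixr \<open>*\<^sub>C\<close> 75)
    and cinner :: "'a \<Rightarrow> 'a \<Rightarrow> complex"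
  assumes scaleC_add_right: "c *\<^sub>C (x + y) = c *\<^sub>C x + c *\<^sub>C y"
    and scaleC_add_left: "(c + d) *\<^sub>C x = c *\<^sub>C x + d *\<^sub>C x"
    and scaleC_scaleC: "c *\<^sub>C (d *\<^sub>C x) = (c * d) *\<^sub>C x"
    and scaleC_of_real: "complex_of_real r *\<^sub>C x = r *\<^sub>R x"
    and cinner_commute: "cinner y x = cnj (cinner x y)"
    and cinner_add_right: "cinner x (y + z) = cinner x y + cinner x z"
    and cinner_scaleC_right: "cinner x (c *\<^sub>C y) = c * cinner x y"
    and inner_eq_Re_cinner: "inner x y = Re (cinner x y)"

lemma vector_space_scaleC:
  "vector_space (scaleC :: complex \<Rightarrow> 'a \<Rightarrow> 'a::complex_hilbert_space)"
proof
  show "1 *\<^sub>C x = x" for x :: 'a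
    using scaleC_of_real[of 1 x] by simp
qed (simp_all add: scaleC_add_right scaleC_add_left scaleC_scaleC)

definition infinite_dimensional :: "'a::complex_hilbert_space itself \<Rightarrow> bool" where
  "infinite_dimensional _ \<longleftrightarrow>
     (\<nexists>B :: 'a set. finite B \<and> module.span scaleC B = UNIV)"

definition separable_type :: "'a::topological_space itself \<Rightarrow> bool" where
  "separable_type _ \<longleftrightarrow> (\<exists>D :: 'a set. countable D \<and> closure D = UNIV)"


section \<open>Operators\<close>

text \<open>
  Elements of \<^typ>\<open>'a \<Rightarrow>\<^sub>L 'a\<close> are only real-linear; \<open>bounded_op\<close> singles out the
  complex-linear ones. The norm, the vector operations and limits are those of that type.
\<close>

definition bounded_op :: "('a::complex_hilbert_space \<Rightarrow>\<^sub>L 'a) \<Rightarrow> bool" where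
  "bounded_op T \<longleftrightarrow> (\<forall>c x. blinfun_apply T (c *\<^sub>C x) = c *\<^sub>C blinfun_apply T x)"

definition self_adjoint :: "('a::complex_hilbert_space \<Rightarrow>\<^sub>L 'a) \<Rightarrow> bool" where
  "self_adjoint T \<longleftrightarrow>
     bounded_op T \<and> (\<forall>x y. cinner (blinfun_apply T x) y = cinner x (blinfun_apply T y))"

text \<open>For self-adjoint \<open>T\<close> the number \<open>\<langle>x, T x\<rangle>\<close> is real.\<close>

definition positive_op :: "('a::complex_hilbert_space \<Rightarrow>\<^sub>L 'a) \<Rightarrow> bool" where
  "positive_op T \<longleftrightarrow> self_adjoint T \<and> (\<forall>x. 0 \<le> Re (cinner x (blinfun_apply T x)))"

definition invertible_op :: "('a::complex_hilbert_space \<Rightarrow>\<^sub>L 'a) \<Rightarrow> bool" where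
  "invertible_op T \<longleftrightarrow>
     (\<exists>S. bounded_op S \<and> S o\<^sub>L T = id_blinfun \<and> T o\<^sub>L S = id_blinfun)"

definition strictly_positive :: "('a::complex_hilbert_space \<Rightarrow>\<^sub>L 'a) \<Rightarrow> bool" where
  "strictly_positive T \<longleftrightarrow> positive_op T \<and> invertible_op T"

definition op_le :: "('a::complex_hilbert_space \<Rightarrow>\<^sub>L 'a) \<Rightarrow> ('a \<Rightarrow>\<^sub>L 'a) \<Rightarrow> bool"
    (infix \<open>\<le>\<^sub>o\<^sub>p\<close> 50) where
  "S \<le>\<^sub>o\<^sub>p T \<longleftrightarrow> positive_op (T - S)"


section \<open>Functional calculus\<close>

lemma bounded_linear_scaleC:
  "bounded_linear (\<lambda>x :: 'a::complex_hilbert_space. c *\<^sub>C x)"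
proof (rule bounded_linear_intro)
  show "c *\<^sub>C (x + y) = c *\<^sub>C x + c *\<^sub>C y" for x y :: 'a
    by (rule scaleC_add_right)
  show "c *\<^sub>C (r *\<^sub>R x) = r *\<^sub>R (c *\<^sub>C x)" for r and x :: 'a
    by (metis scaleC_of_real scaleC_scaleC mult.commute)
  show "norm (c *\<^sub>C x) \<le> norm x * cmod c" for x :: 'a
  proof -
    have left: "cinner (c *\<^sub>C x) y = cnj c * cinner x y" for y
      by (metis cinner_commute cinner_scaleC_right complex_cnj_mult)
    have "cinner x x = complex_of_real (x \<bullet> x)"
      by (metis Reals_cnj_iff cinner_commute inner_eq_Re_cinner of_real_Re)
    then have "cinner (c *\<^sub>C x) (c *\<^sub>C x) = complex_of_real ((cmod c)\<^sup>2 * (norm x)\<^sup>2)"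
      by (simp only: left cinner_scaleC_right dot_square_norm of_real_mult complex_norm_square
          mult_ac)
    then have "(norm (c *\<^sub>C x))\<^sup>2 = (norm x * cmod c)\<^sup>2"
      by (simp add: power2_norm_eq_inner inner_eq_Re_cinner power_mult_distrib mult.commute)
    then show ?thesis
      by (simp add: power2_eq_iff_nonneg)
  qed
qed

lift_definition scalar_op :: "complex \<Rightarrow> 'a::complex_hilbert_space \<Rightarrow>\<^sub>L 'a"
  is "\<lambda>c x. c *\<^sub>C x" by (rule bounded_linear_scaleC)

definition spectrum :: "('a::complex_hilbert_space \<Rightarrow>\<^sub>L 'a) \<Rightarrow> complex set" where
  "spectrum T = {z. \<not> invertible_op (T - scalar_op z)}"

definition poly_op :: "real poly \<Rightarrow> ('a::complex_hilbert_space \<Rightarrow>\<^sub>L 'a) \<Rightarrow> 'a \<Rightarrow>\<^sub>L 'a" where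
  "poly_op p T = (\<Sum>i\<le>degree p. coeff p i *\<^sub>R (((o\<^sub>L) T ^^ i) id_blinfun))"

text \<open>
  Continuous functional calculus of a self-adjoint operator \<open>T\<close>, whose spectrum is real:
  \<open>f(T)\<close> is the norm limit of \<open>p\<^sub>n(T)\<close> for real polynomials \<open>p\<^sub>n\<close> converging to \<open>f\<close>
  uniformly on the spectrum. If \<open>f\<close> is continuous there, such \<open>p\<^sub>n\<close> exist (Weierstrass) and
  the limit exists and does not depend on their choice. Otherwise the value is unspecified.
\<close>

definition fun_calc :: "(real \<Rightarrow> real) \<Rightarrow> ('a::complex_hilbert_space \<Rightarrow>\<^sub>L 'a) \<Rightarrow> 'a \<Rightarrow>\<^sub>L 'a" where
  "fun_calc f T = (THE S. \<exists>p :: nat \<Rightarrow> real poly.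
     uniform_limit {t. complex_of_real t \<in> spectrum T} (\<lambda>n. poly (p n)) f sequentially \<and>
     (\<lambda>n. poly_op (p n) T) \<longlonglongrightarrow> S)"

definition op_powr :: "('a::complex_hilbert_space \<Rightarrow>\<^sub>L 'a) \<Rightarrow> real \<Rightarrow> 'a \<Rightarrow>\<^sub>L 'a"
    (infixr \<open>powr\<^sub>o\<^sub>p\<close> 80) where
  "T powr\<^sub>o\<^sub>p r = fun_calc (\<lambda>t. t powr r) T"


section \<open>The Tsallis relative operator entropy and joint convexity\<close>

definition tsallis_ln :: "real \<Rightarrow> ('a::complex_hilbert_space \<Rightarrow>\<^sub>L 'a) \<Rightarrow> 'a \<Rightarrow>\<^sub>L 'a" where
  "tsallis_ln r X = (1 / r) *\<^sub>R (X powr\<^sub>o\<^sub>p r - id_blinfun)"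

definition tsallis_entropy ::
    "real \<Rightarrow> real \<Rightarrow> ('a::complex_hilbert_space \<Rightarrow>\<^sub>L 'a) \<Rightarrow> ('a \<Rightarrow>\<^sub>L 'a) \<Rightarrow> 'a \<Rightarrow>\<^sub>L 'a" where
  "tsallis_entropy \<alpha> \<beta> A B =
     A powr\<^sub>o\<^sub>p (\<beta>/2)
       o\<^sub>L tsallis_ln \<alpha> (A powr\<^sub>o\<^sub>p (-\<beta>/2) o\<^sub>L B o\<^sub>L A powr\<^sub>o\<^sub>p (-\<beta>/2))
       o\<^sub>L A powr\<^sub>o\<^sub>p (\<beta>/2)"

definition jointly_convex ::
    "(('a::complex_hilbert_space \<Rightarrow>\<^sub>L 'a) \<Rightarrow> ('a \<Rightarrow>\<^sub>L 'a) \<Rightarrow> 'a \<Rightarrow>\<^sub>L 'a) \<Rightarrow> bool" where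
  "jointly_convex g \<longleftrightarrow>
     (\<forall>A B. strictly_positive A \<longrightarrow> strictly_positive B \<longrightarrow> self_adjoint (g A B)) \<and>
     (\<forall>A\<^sub>1 A\<^sub>2 B\<^sub>1 B\<^sub>2. \<forall>c\<in>{0..1::real}.
        strictly_positive A\<^sub>1 \<longrightarrow> strictly_positive A\<^sub>2 \<longrightarrow>
        strictly_positive B\<^sub>1 \<longrightarrow> strictly_positive B\<^sub>2 \<longrightarrow>
        g (c *\<^sub>R A\<^sub>1 + (1 - c) *\<^sub>R A\<^sub>2) (c *\<^sub>R B\<^sub>1 + (1 - c) *\<^sub>R B\<^sub>2)
          \<le>\<^sub>o\<^sub>p c *\<^sub>R g A\<^sub>1 B\<^sub>1 + (1 - c) *\<^sub>R g A\<^sub>2 B\<^sub>2)"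

end

theory Submission
  imports Defs "HOL-Computational_Algebra.Fundamental_Theorem_Algebra"
begin

text \<open>
  Multiplying out, \<open>\<alpha> T\<^bsub>\<alpha>,\<beta>\<^esub>(A|B) = P(A, B) - A\<^sup>\<beta>\<close> with
  \<open>P(A, B) = A\<^bsup>\<beta>/2\<^esup> (A\<^bsup>-\<beta>/2\<^esup> B A\<^bsup>-\<beta>/2\<^esup>)\<^sup>\<alpha> A\<^bsup>\<beta>/2\<^esup>\<close>. The
  claim follows from the operator concavity of \<open>A \<mapsto> A\<^sup>\<beta>\<close> and the joint convexity of \<open>P\<close>.

  Both reduce to inverses by one fact about real functions: for \<open>0 \<le> \<gamma> \<le> 1\<close>, the power
  \<open>t\<^sup>\<gamma>\<close> is, uniformly on compact subsets of the open half-line, a limit of finite sums of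
  fractions \<open>t / (a t + b)\<close> with \<open>a, b \<ge> 0\<close> (\<open>powr_approx\<close>). It takes the place of the usual
  integral representation and is obtained from a two-sided geometric series. For \<open>\<gamma> = \<beta>\<close>
  it shows that \<open>A\<^sup>\<beta>\<close> is a norm limit of sums of \<open>A (a A + b)\<^sup>-\<^sup>1\<close>, which are concave
  because the inverse is operator convex. For \<open>\<gamma> = \<alpha> - 1\<close>, multiplied by another \<open>t\<close>, it shows
  that \<open>P(A, B)\<close> is a norm limit of sums of \<open>B (a B + b A\<^sup>\<beta>)\<^sup>-\<^sup>1 B\<close>: the square roots cancel
  (\<open>sandwich_fraction\<close>). Now \<open>(X, W) \<mapsto> X W\<^sup>-\<^sup>1 X\<close> is jointly convex and decreasing in \<open>W\<close>
  (\<open>quadratic_over_linear_convex\<close>), and \<open>a B + b A\<^sup>\<beta>\<close> is concave in \<open>(A, B)\<close>, so each summand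
  is jointly convex.

  The functional calculus rests on the bound of \<open>\<parallel>p(T)\<parallel>\<close> by the supremum of \<open>\<bar>p\<bar>\<close> on the spectrum
  of a symmetric operator \<open>T\<close> (\<open>norm_peval_le\<close>). The bound makes the limit defining \<open>f(T)\<close> exist and
  be unique, and turns uniform convergence of functions into norm convergence of operators.
\<close>


section \<open>The algebra of bounded complex-linear operators\<close>

text \<open>
  The complex-linear operators get a type of their own, so that sums, products, norms, limits and the
  order come with the laws of the library's classes. The algebra has a unit, but it
  is no \<open>real_normed_algebra_1\<close>, because \<open>1 = 0\<close> on the trivial space.
\<close>

typedef (overloaded) 'a operator = "{T :: 'a::complex_hilbert_space \<Rightarrow>\<^sub>L 'a. bounded_op T}"
  morphisms blinfun_of Operator
proof
  show "0 \<in> {T :: 'a \<Rightarrow>\<^sub>L 'a. bounded_op T}"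
    using bounded_linear.linear[OF bounded_linear_scaleC] linear_0
    by (fastforce simp: bounded_op_def)
qed

setup_lifting type_definition_operator

lemma scaleC_scaleR: "c *\<^sub>C (r *\<^sub>R x) = r *\<^sub>R (c *\<^sub>C x)"
  using bounded_linear_scaleC by (rule linear_simps)

lemma scaleC_zero_right [simp]: "c *\<^sub>C 0 = 0"
  using bounded_linear_scaleC by (rule linear_simps)

lemma scaleC_diff_right: "c *\<^sub>C (x - y) = c *\<^sub>C x - c *\<^sub>C y"
  using bounded_linear_scaleC by (rule linear_simps)

lemma scaleC_minus_right: "c *\<^sub>C (- x) = - (c *\<^sub>C x)"
  using bounded_linear_scaleC by (rule linear_simps)

instantiation operator :: (complex_hilbert_space) "{monoid_mult, ring}"
begin

lift_definition zero_operator :: "'a operator" is 0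
  by (simp add: bounded_op_def)
lift_definition one_operator :: "'a operator" is id_blinfun
  by (simp add: bounded_op_def)
lift_definition plus_operator :: "'a operator \<Rightarrow> 'a operator \<Rightarrow> 'a operator" is "(+)"
  by (simp add: bounded_op_def blinfun.add_left scaleC_add_right)
lift_definition minus_operator :: "'a operator \<Rightarrow> 'a operator \<Rightarrow> 'a operator" is "(-)"
  by (simp add: bounded_op_def blinfun.diff_left scaleC_diff_right)
lift_definition uminus_operator :: "'a operator \<Rightarrow> 'a operator" is uminus
  by (simp add: bounded_op_def blinfun.minus_left scaleC_minus_right)
lift_definition times_operator :: "'a operator \<Rightarrow> 'a operator \<Rightarrow> 'a operator" is "(o\<^sub>L)"
  by (simp add: bounded_op_def)

instance
  by standard (transfer; auto intro!: blinfun_eqI simp: blinfun.bilinear_simps)+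

end

instantiation operator :: (complex_hilbert_space) real_normed_algebra
begin

lift_definition scaleR_operator :: "real \<Rightarrow> 'a operator \<Rightarrow> 'a operator" is "(*\<^sub>R)"
  by (simp add: bounded_op_def blinfun.scaleR_left scaleC_scaleR)
lift_definition norm_operator :: "'a operator \<Rightarrow> real" is norm .
definition dist_operator :: "'a operator \<Rightarrow> 'a operator \<Rightarrow> real"
  where "dist_operator S T = norm (S - T)"
definition sgn_operator :: "'a operator \<Rightarrow> 'a operator"
  where "sgn_operator T = inverse (norm T) *\<^sub>R T"
definition uniformity_operator :: "('a operator \<times> 'a operator) filter"
  where "uniformity_operator = (INF e\<in>{0 <..}. principal {(x, y). dist x y < e})"
definition open_operator :: "'a operator set \<Rightarrow> bool"
  where "open_operator U = (\<forall>x\<in>U. \<forall>\<^sub>F (x', y) in uniformity. x' = x \<longrightarrow> y \<in> U)"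

lemma dist_blinfun_of: "dist (blinfun_of S) (blinfun_of T) = dist S T"
  unfolding dist_operator_def dist_norm by transfer simp

instance
proof
  fix S T U :: "'a operator" and a b :: real
  show "a *\<^sub>R (S + T) = a *\<^sub>R S + a *\<^sub>R T" "(a + b) *\<^sub>R S = a *\<^sub>R S + b *\<^sub>R S"
    "a *\<^sub>R b *\<^sub>R S = (a * b) *\<^sub>R S" "1 *\<^sub>R S = S"
    by (transfer; simp add: scaleR_add_right scaleR_add_left)+
  show "dist S T = norm (S - T)" "sgn S = inverse (norm S) *\<^sub>R S"
    by (simp_all add: dist_operator_def sgn_operator_def)
  show "(norm S = 0) = (S = 0)" "norm (S + T) \<le> norm S + norm T"
    "norm (a *\<^sub>R S) = \<bar>a\<bar> * norm S"
    by (transfer; simp add: norm_triangle_ineq)+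
  show "a *\<^sub>R S * T = a *\<^sub>R (S * T)" "S * a *\<^sub>R T = a *\<^sub>R (S * T)"
    by (transfer; auto intro!: blinfun_eqI simp: blinfun.bilinear_simps)+
  show "norm (S * T) \<le> norm S * norm T"
    by transfer (rule norm_blinfun_compose)
qed (simp_all add: uniformity_operator_def open_operator_def)

end

instance operator :: (complex_hilbert_space) banach
proof
  fix X :: "nat \<Rightarrow> 'a operator"
  assume "Cauchy X"
  then have "Cauchy (\<lambda>n. blinfun_of (X n))"
    by (simp add: Cauchy_def dist_blinfun_of)
  then obtain L where L: "(\<lambda>n. blinfun_of (X n)) \<longlonglongrightarrow> L"
    using Cauchy_convergent convergent_def by blast
  have app: "(\<lambda>n. blinfun_of (X n) x) \<longlonglongrightarrow> L x" for x
    using L by (intro blinfun.tendsto) auto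
  have "L (c *\<^sub>C x) = c *\<^sub>C L x" for c x
  proof (rule LIMSEQ_unique)
    show "(\<lambda>n. blinfun_of (X n) (c *\<^sub>C x)) \<longlonglongrightarrow> L (c *\<^sub>C x)"
      by (rule app)
    have "(\<lambda>n. c *\<^sub>C blinfun_of (X n) x) \<longlonglongrightarrow> c *\<^sub>C L x"
      using app by (rule bounded_linear.tendsto[OF bounded_linear_scaleC])
    then show "(\<lambda>n. blinfun_of (X n) (c *\<^sub>C x)) \<longlonglongrightarrow> c *\<^sub>C L x"
      using blinfun_of[of "X n" for n] by (simp add: bounded_op_def)
  qed
  then have "blinfun_of (Operator L) = L"
    by (simp add: Operator_inverse bounded_op_def)
  then have "X \<longlonglongrightarrow> Operator L"
    using L by (simp add: lim_sequentially flip: dist_blinfun_of)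
  then show "convergent X"
    by (auto simp: convergent_def)
qed

lift_definition apply_op :: "'a::complex_hilbert_space operator \<Rightarrow> 'a \<Rightarrow> 'a" (infixr \<open>\<cdot>\<close> 75)
  is blinfun_apply .

lemma operator_eqI: "(\<And>x. S \<cdot> x = T \<cdot> x) \<Longrightarrow> S = T"
  by transfer (rule blinfun_eqI)

lemma apply_op_simps [simp]:
  "0 \<cdot> x = 0" "1 \<cdot> x = x" "(S + T) \<cdot> x = S \<cdot> x + T \<cdot> x" "(S - T) \<cdot> x = S \<cdot> x - T \<cdot> x"
  "(- T) \<cdot> x = - (T \<cdot> x)" "(r *\<^sub>R T) \<cdot> x = r *\<^sub>R (T \<cdot> x)" "(S * T) \<cdot> x = S \<cdot> T \<cdot> x"
  by (transfer; simp add: blinfun.bilinear_simps)+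

lemma bounded_linear_apply_op: "bounded_linear (\<lambda>x. T \<cdot> x)"
  by transfer (rule blinfun.bounded_linear_right)

lemmas apply_op_linear [simp] =
  linear_simps[OF bounded_linear_apply_op]

lemma norm_apply_op: "norm (T \<cdot> x) \<le> norm T * norm x"
  by transfer (rule norm_blinfun)

lemma norm_operator_le:
  "0 \<le> b \<Longrightarrow> (\<And>x. norm (T \<cdot> x) \<le> b * norm x) \<Longrightarrow> norm T \<le> b"
  by transfer (rule norm_blinfun_bound)

lemma apply_op_scaleC: "T \<cdot> (c *\<^sub>C x) = c *\<^sub>C (T \<cdot> x)"
  by transfer (simp add: bounded_op_def)

lemma tendsto_blinfun_of:
  "(\<lambda>n. blinfun_of (X n)) \<longlonglongrightarrow> blinfun_of L \<longleftrightarrow> X \<longlonglongrightarrow> L"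
  by (simp add: lim_sequentially dist_blinfun_of)

lemma tendsto_apply_op: "X \<longlonglongrightarrow> L \<Longrightarrow> (\<lambda>n. X n \<cdot> x) \<longlonglongrightarrow> L \<cdot> x"
  by (simp add: apply_op.rep_eq tendsto_blinfun_of blinfun.tendsto)


section \<open>Symmetric operators and the Loewner order\<close>

definition symmetric :: "'a::complex_hilbert_space operator \<Rightarrow> bool"
  where "symmetric T \<longleftrightarrow> (\<forall>x y. (T \<cdot> x) \<bullet> y = x \<bullet> (T \<cdot> y))"

lemma symmetricD: "symmetric T \<Longrightarrow> (T \<cdot> x) \<bullet> y = x \<bullet> (T \<cdot> y)"
  by (simp add: symmetric_def)

lemma symmetric_simps [simp]:
  "symmetric 0" "symmetric 1"
  "symmetric S \<Longrightarrow> symmetric T \<Longrightarrow> symmetric (S + T)"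
  "symmetric S \<Longrightarrow> symmetric T \<Longrightarrow> symmetric (S - T)"
  "symmetric T \<Longrightarrow> symmetric (r *\<^sub>R T)"
  "symmetric T \<Longrightarrow> symmetric (- T)"
  by (simp_all add: symmetric_def inner_simps)

lemma symmetric_mult_commute:
  "symmetric S \<Longrightarrow> symmetric T \<Longrightarrow> S * T = T * S \<Longrightarrow> symmetric (S * T)"
  by (metis apply_op_simps(7) symmetric_def)

lemma symmetric_sandwich: "symmetric C \<Longrightarrow> symmetric T \<Longrightarrow> symmetric (C * T * C)"
  by (simp add: symmetric_def)

lemma symmetric_limit:
  assumes "\<And>n. symmetric (X n)" "X \<longlonglongrightarrow> L"
  shows "symmetric L"
proof -
  have "(L \<cdot> x) \<bullet> y = x \<bullet> (L \<cdot> y)" for x y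
  proof (rule LIMSEQ_unique)
    show "(\<lambda>n. (X n \<cdot> x) \<bullet> y) \<longlonglongrightarrow> (L \<cdot> x) \<bullet> y"
      by (intro tendsto_intros tendsto_apply_op assms)
    show "(\<lambda>n. (X n \<cdot> x) \<bullet> y) \<longlonglongrightarrow> x \<bullet> (L \<cdot> y)"
      unfolding symmetricD[OF assms(1)] by (intro tendsto_intros tendsto_apply_op assms)
  qed
  then show ?thesis
    by (simp add: symmetric_def)
qed

text \<open>
  The order requires symmetry of the difference, not of the two operators, which makes it
  translation invariant on the whole algebra.
\<close>

instantiation operator :: (complex_hilbert_space) ordered_real_vector
begin

definition less_eq_operator :: "'a operator \<Rightarrow> 'a operator \<Rightarrow> bool"
  where "S \<le> T \<longleftrightarrow> symmetric (T - S) \<and> (\<forall>x. x \<bullet> (S \<cdot> x) \<le> x \<bullet> (T \<cdot> x))"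
definition less_operator :: "'a operator \<Rightarrow> 'a operator \<Rightarrow> bool"
  where "S < T \<longleftrightarrow> S \<le> T \<and> \<not> T \<le> (S :: 'a operator)"

instance
proof
  fix S T U :: "'a operator" and a b :: real
  show "S < T \<longleftrightarrow> S \<le> T \<and> \<not> T \<le> S"
    by (rule less_operator_def)
  show "S \<le> S"
    by (simp add: less_eq_operator_def)
  show "S \<le> U" if "S \<le> T" "T \<le> U"
  proof -
    have "symmetric ((T - S) + (U - T))"
      using that by (intro symmetric_simps(3)) (auto simp: less_eq_operator_def)
    then show ?thesis
      using that unfolding less_eq_operator_def by (auto intro: order_trans)
  qed
  show "S = T" if "S \<le> T" "T \<le> S"
  proof -
    define D where "D = T - S"
    have symm: "symmetric D"
      using that by (simp add: less_eq_operator_def D_def)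
    have quad: "x \<bullet> (D \<cdot> x) = 0" for x
      using that by (auto simp: less_eq_operator_def D_def inner_simps intro: antisym)
    have "D \<cdot> x = 0" for x
    proof -
      \<comment> \<open>polarization: a symmetric operator is determined by its quadratic form\<close>
      have "(x + D \<cdot> x) \<bullet> (D \<cdot> (x + D \<cdot> x)) = 2 * ((D \<cdot> x) \<bullet> (D \<cdot> x))"
        using quad[of x] quad[of "D \<cdot> x"] symmetricD[OF symm, of x "D \<cdot> x"]
        by (simp add: inner_simps)
      then show ?thesis
        using quad[of "x + D \<cdot> x"] by simp
    qed
    then show ?thesis
      by (intro operator_eqI) (simp add: D_def)
  qed
  show "U + S \<le> U + T" if "S \<le> T"
    using that by (simp add: less_eq_operator_def inner_simps)
  show "a *\<^sub>R S \<le> a *\<^sub>R T" if "S \<le> T" "0 \<le> a"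
    using that symmetric_simps(5)[of "T - S" a]
    by (simp add: less_eq_operator_def mult_left_mono scaleR_diff_right)
  show "a *\<^sub>R S \<le> b *\<^sub>R S" if "a \<le> b" "0 \<le> S"
    using that symmetric_simps(5)[of S "b - a"]
    by (simp add: less_eq_operator_def mult_right_mono scaleR_diff_left)
qed

end

lemma operator_leI:
  "symmetric (T - S) \<Longrightarrow> (\<And>x. x \<bullet> (S \<cdot> x) \<le> x \<bullet> (T \<cdot> x)) \<Longrightarrow> S \<le> T"
  by (simp add: less_eq_operator_def)

lemma operator_leD: "S \<le> T \<Longrightarrow> x \<bullet> (S \<cdot> x) \<le> x \<bullet> (T \<cdot> x)"
  by (simp add: less_eq_operator_def)

lemma nonneg_imp_symmetric: "0 \<le> T \<Longrightarrow> symmetric T"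
  by (simp add: less_eq_operator_def)

lemma operator_le_limit:
  fixes X :: "nat \<Rightarrow> 'a::complex_hilbert_space operator"
  assumes "\<And>n. X n \<le> Y n" "X \<longlonglongrightarrow> S" "Y \<longlonglongrightarrow> T"
  shows "S \<le> T"
proof (rule operator_leI)
  show "symmetric (T - S)"
    using tendsto_diff[OF assms(3,2)]
    by (rule symmetric_limit[rotated]) (use assms(1) in \<open>simp add: less_eq_operator_def\<close>)
  show "x \<bullet> (S \<cdot> x) \<le> x \<bullet> (T \<cdot> x)" for x
  proof (rule LIMSEQ_le)
    show "(\<lambda>n. x \<bullet> (X n \<cdot> x)) \<longlonglongrightarrow> x \<bullet> (S \<cdot> x)"
      "(\<lambda>n. x \<bullet> (Y n \<cdot> x)) \<longlonglongrightarrow> x \<bullet> (T \<cdot> x)"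
      by (intro tendsto_intros tendsto_apply_op assms)+
  qed (use assms(1) operator_leD in blast)
qed

lemma sandwich_mono:
  assumes "symmetric C" "S \<le> T"
  shows "C * S * C \<le> C * T * C"
proof (rule operator_leI)
  have "symmetric (C * (T - S) * C)"
    using assms by (intro symmetric_sandwich) (simp_all add: less_eq_operator_def)
  then show "symmetric (C * T * C - C * S * C)"
    by (simp add: algebra_simps)
  have "(C \<cdot> x) \<bullet> (S \<cdot> C \<cdot> x) \<le> (C \<cdot> x) \<bullet> (T \<cdot> C \<cdot> x)" for x
    using assms(2) by (rule operator_leD)
  then show "x \<bullet> ((C * S * C) \<cdot> x) \<le> x \<bullet> ((C * T * C) \<cdot> x)" for x
    by (simp add: symmetricD[OF assms(1)])
qed

lemma square_nonneg:
  assumes "symmetric C" shows "0 \<le> C * C"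
proof (rule operator_leI)
  have "x \<bullet> ((C * C) \<cdot> x) = (C \<cdot> x) \<bullet> (C \<cdot> x)" for x
    by (simp add: symmetricD[OF assms])
  then show "x \<bullet> (0 \<cdot> x) \<le> x \<bullet> ((C * C) \<cdot> x)" for x
    by simp
qed (simp add: assms symmetric_mult_commute)

lemma symmetric_le_norm:
  assumes "symmetric T" shows "T \<le> norm T *\<^sub>R 1"
proof (rule operator_leI)
  fix x
  have "x \<bullet> (T \<cdot> x) \<le> norm x * norm (T \<cdot> x)"
    by (rule norm_cauchy_schwarz)
  also have "\<dots> \<le> norm x * (norm T * norm x)"
    by (intro mult_left_mono norm_apply_op) auto
  also have "\<dots> = x \<bullet> ((norm T *\<^sub>R 1) \<cdot> x)"
    by (simp add: dot_square_norm power2_eq_square)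
  finally show "x \<bullet> (T \<cdot> x) \<le> x \<bullet> ((norm T *\<^sub>R 1) \<cdot> x)" .
qed (simp add: assms)


section \<open>Invertibility\<close>

definition unit_op :: "'a::complex_hilbert_space operator \<Rightarrow> bool"
  where "unit_op T \<longleftrightarrow> (\<exists>S. S * T = 1 \<and> T * S = 1)"

lemma unit_op_mult:
  assumes "unit_op S" "unit_op T" shows "unit_op (S * T)"
proof -
  obtain S' T' where "S' * S = 1" "S * S' = 1" "T' * T = 1" "T * T' = 1"
    using assms by (auto simp: unit_op_def)
  then have "(T' * S') * (S * T) = 1" "(S * T) * (T' * S') = 1"
    by (metis mult.assoc mult_1_left)+
  then show ?thesis
    unfolding unit_op_def by blast
qed

lemma unit_op_scaleR:
  assumes "unit_op T" "r \<noteq> 0" shows "unit_op (r *\<^sub>R T)"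
proof -
  obtain S where "S * T = 1" "T * S = 1"
    using assms by (auto simp: unit_op_def)
  then have "(inverse r *\<^sub>R S) * (r *\<^sub>R T) = 1" "(r *\<^sub>R T) * (inverse r *\<^sub>R S) = 1"
    using assms by simp_all
  then show ?thesis
    unfolding unit_op_def by blast
qed

text \<open>
  The Lax--Milgram argument: \<open>x \<mapsto> x - \<tau>(T x - y)\<close> is a contraction for small \<open>\<tau>\<close>, and its
  fixed point solves \<open>T x = y\<close>.
\<close>

lemma coercive_imp_unit_op:
  assumes "0 < \<delta>" and coercive: "\<And>x. \<delta> * (x \<bullet> x) \<le> x \<bullet> (T \<cdot> x)"
  shows "unit_op T"
proof -
  define K where "K = norm T + \<delta>"
  \<comment> \<open>\<open>\<tau>\<close> minimizes the bound \<open>1 - 2 \<tau> \<delta> + \<tau>\<^sup>2 K\<^sup>2\<close> for the squared contraction factor\<close>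
  define \<tau> where "\<tau> = \<delta> / K\<^sup>2"
  define c where "c = sqrt (1 - \<delta>\<^sup>2 / K\<^sup>2)"
  have "0 < K" "\<delta> \<le> K" "norm T \<le> K"
    using \<open>0 < \<delta>\<close> by (auto simp: K_def add_nonneg_pos)
  then have ratio: "0 < \<delta>\<^sup>2 / K\<^sup>2" "\<delta>\<^sup>2 / K\<^sup>2 \<le> 1"
    using \<open>0 < \<delta>\<close> by (auto simp: power_mono)
  have c: "0 \<le> c" "c < 1" "c\<^sup>2 = 1 - \<delta>\<^sup>2 / K\<^sup>2"
    using ratio by (auto simp: c_def)
  have contraction: "norm (d - \<tau> *\<^sub>R (T \<cdot> d)) \<le> c * norm d" for d
  proof (rule power2_le_imp_le)
    have "norm (T \<cdot> d) \<le> K * norm d"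
      using norm_apply_op[of T d] mult_right_mono[OF \<open>norm T \<le> K\<close> norm_ge_zero[of d]] by linarith
    then have "(norm (T \<cdot> d))\<^sup>2 \<le> (K * norm d)\<^sup>2"
      by (intro power_mono) auto
    then have bound: "(T \<cdot> d) \<bullet> (T \<cdot> d) \<le> K\<^sup>2 * (d \<bullet> d)"
      by (simp add: power_mult_distrib power2_norm_eq_inner)
    have "(norm (d - \<tau> *\<^sub>R (T \<cdot> d)))\<^sup>2
        = d \<bullet> d - 2 * \<tau> * (d \<bullet> (T \<cdot> d)) + \<tau>\<^sup>2 * ((T \<cdot> d) \<bullet> (T \<cdot> d))"
      unfolding power2_norm_eq_inner
      by (simp add: inner_simps inner_commute algebra_simps power2_eq_square)
    also have "\<dots> \<le> d \<bullet> d - 2 * \<tau> * (\<delta> * (d \<bullet> d)) + \<tau>\<^sup>2 * (K\<^sup>2 * (d \<bullet> d))"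
      using bound coercive[of d] \<open>0 < \<delta>\<close>
      by (intro add_mono diff_mono mult_left_mono) (auto simp: \<tau>_def)
    also have "\<dots> = (1 - \<delta>\<^sup>2 / K\<^sup>2) * (d \<bullet> d)"
      using \<open>0 < K\<close> by (simp add: \<tau>_def field_simps power2_eq_square)
    also have "\<dots> = (c * norm d)\<^sup>2"
      by (simp add: c power_mult_distrib power2_norm_eq_inner)
    finally show "(norm (d - \<tau> *\<^sub>R (T \<cdot> d)))\<^sup>2 \<le> (c * norm d)\<^sup>2" .
  qed (use c in auto)
  have "\<exists>x. T \<cdot> x = y" for y
  proof -
    let ?f = "\<lambda>x. x - \<tau> *\<^sub>R (T \<cdot> x - y)"
    have "dist (?f x) (?f x') \<le> c * dist x x'" for x x'
    proof -
      have "?f x - ?f x' = (x - x') - \<tau> *\<^sub>R (T \<cdot> (x - x'))"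
        by (simp add: algebra_simps)
      then show ?thesis
        unfolding dist_norm by (simp only: contraction)
    qed
    then obtain x where "?f x = x"
      using banach_fix_type[OF c(1,2), of ?f] by blast
    moreover have "\<tau> \<noteq> 0"
      using \<open>0 < \<delta>\<close> \<open>0 < K\<close> by (simp add: \<tau>_def)
    ultimately show ?thesis
      by (intro exI[of _ x]) simp
  qed
  then obtain g where g: "T \<cdot> g y = y" for y
    by metis
  have inj: "x = y" if "T \<cdot> x = T \<cdot> y" for x y
  proof -
    have "\<delta> * ((x - y) \<bullet> (x - y)) \<le> 0"
      using coercive[of "x - y"] that by simp
    then show ?thesis
      using \<open>0 < \<delta>\<close> by (metis eq_iff_diff_eq_0 inner_gt_zero_iff mult_pos_pos not_less)
  qed
  have "bounded_linear g"
  proof (rule bounded_linear_intro[where K = "1 / \<delta>"])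
    show "g (x + y) = g x + g y" "g (r *\<^sub>R x) = r *\<^sub>R g x" for x y r
      by (rule inj; simp add: g)+
    show "norm (g y) \<le> norm y * (1 / \<delta>)" for y
    proof (cases "g y = 0")
      case False
      have "\<delta> * (norm (g y) * norm (g y)) \<le> g y \<bullet> y"
        using coercive[of "g y"] by (simp add: g dot_square_norm power2_eq_square)
      also have "\<dots> \<le> norm (g y) * norm y"
        by (rule norm_cauchy_schwarz)
      finally have "norm (g y) * (\<delta> * norm (g y)) \<le> norm (g y) * norm y"
        by (simp add: mult_ac)
      then have "\<delta> * norm (g y) \<le> norm y"
        using False by simp
      then show ?thesis
        using \<open>0 < \<delta>\<close> by (simp add: field_simps)
    qed (use \<open>0 < \<delta>\<close> in auto)
  qed
  then have "Blinfun g y = g y" for y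
    by (simp add: bounded_linear_Blinfun_apply)
  moreover have "g (c *\<^sub>C y) = c *\<^sub>C g y" for c y
    by (rule inj) (simp add: g apply_op_scaleC)
  ultimately have S: "Operator (Blinfun g) \<cdot> y = g y" for y
    by (simp add: apply_op.rep_eq Operator_inverse bounded_op_def)
  have "T * Operator (Blinfun g) = 1" "Operator (Blinfun g) * T = 1"
    by (rule operator_eqI; auto simp: S g intro: inj)+
  then show ?thesis
    by (auto simp: unit_op_def)
qed

lemma strictly_pos_imp_unit_op: "0 < \<delta> \<Longrightarrow> \<delta> *\<^sub>R 1 \<le> T \<Longrightarrow> unit_op T"
  by (rule coercive_imp_unit_op[of \<delta>]) (auto dest: operator_leD)

text \<open>
  A symmetric \<open>S\<close> almost attains its norm \<open>N\<close> at unit vectors \<open>x\<close>, and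
  \<open>\<parallel>(N\<^sup>2 - S\<^sup>2)x\<parallel>\<^sup>2 \<le> N\<^sup>2 (N\<^sup>2 - \<parallel>S x\<parallel>\<^sup>2)\<close> shows that those
  are approximate null vectors of \<open>N\<^sup>2 - S\<^sup>2\<close>.
\<close>

lemma not_unit_op_norm:
  assumes "symmetric S" "S \<noteq> 0"
  shows "\<not> unit_op ((norm S)\<^sup>2 *\<^sub>R 1 - S * S)"
proof
  define N where "N = norm S"
  assume "unit_op ((norm S)\<^sup>2 *\<^sub>R 1 - S * S)"
  then obtain V where "V * (N\<^sup>2 *\<^sub>R 1 - S * S) = 1"
    by (auto simp: unit_op_def N_def)
  then have "(V * (N\<^sup>2 *\<^sub>R 1 - S * S)) \<cdot> x = x" for x
    by simp
  then have V: "V \<cdot> (N\<^sup>2 *\<^sub>R x - S \<cdot> S \<cdot> x) = x" for x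
    by (simp del: apply_op_linear)
  have "0 < N"
    using assms by (simp add: N_def)
  define v where "v = norm V + 1"
  have "0 < v"
    by (simp add: v_def add_nonneg_pos)
  define \<kappa> where "\<kappa> = 1 / (v\<^sup>2 * N\<^sup>2)"
  have "0 < \<kappa>"
    using \<open>0 < v\<close> \<open>0 < N\<close> by (simp add: \<kappa>_def)
  have "(norm (S \<cdot> x))\<^sup>2 \<le> (N\<^sup>2 - \<kappa>) * (norm x)\<^sup>2" for x
  proof -
    let ?z = "N\<^sup>2 *\<^sub>R x - S \<cdot> S \<cdot> x"
    have "norm (V \<cdot> ?z) \<le> norm V * norm ?z"
      by (rule norm_apply_op)
    also have "\<dots> \<le> v * norm ?z"
      by (intro mult_right_mono) (auto simp: v_def)
    finally have "(norm x)\<^sup>2 \<le> (v * norm ?z)\<^sup>2"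
      unfolding V by (intro power_mono) auto
    then have lower: "(norm x)\<^sup>2 \<le> v\<^sup>2 * (norm ?z)\<^sup>2"
      by (simp add: power_mult_distrib)
    have "norm (S \<cdot> S \<cdot> x) \<le> N * norm (S \<cdot> x)"
      unfolding N_def by (rule norm_apply_op)
    then have SS: "(norm (S \<cdot> S \<cdot> x))\<^sup>2 \<le> N\<^sup>2 * (norm (S \<cdot> x))\<^sup>2"
      by (metis norm_ge_zero power_mono power_mult_distrib)
    have "(norm ?z)\<^sup>2 = N\<^sup>2 * (N\<^sup>2 * (norm x)\<^sup>2 - 2 * (norm (S \<cdot> x))\<^sup>2) + (norm (S \<cdot> S \<cdot> x))\<^sup>2"
      using symmetricD[OF assms(1), of x "S \<cdot> x"]
      by (simp add: power2_norm_eq_inner inner_simps inner_commute algebra_simps)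
    also have "\<dots> \<le> N\<^sup>2 * (N\<^sup>2 * (norm x)\<^sup>2 - (norm (S \<cdot> x))\<^sup>2)"
      using SS by (simp add: algebra_simps)
    finally have "(norm x)\<^sup>2 \<le> v\<^sup>2 * (N\<^sup>2 * (N\<^sup>2 * (norm x)\<^sup>2 - (norm (S \<cdot> x))\<^sup>2))"
      using lower by (meson mult_left_mono order_trans zero_le_power2)
    then have "\<kappa> * (norm x)\<^sup>2 \<le> N\<^sup>2 * (norm x)\<^sup>2 - (norm (S \<cdot> x))\<^sup>2"
      using \<open>0 < v\<close> \<open>0 < N\<close> by (simp add: \<kappa>_def field_simps)
    then show ?thesis
      by (simp add: algebra_simps)
  qed
  then have "(norm (S \<cdot> x))\<^sup>2 \<le> (sqrt (max 0 (N\<^sup>2 - \<kappa>)) * norm x)\<^sup>2" for x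
    by (rule order_trans) (simp add: power_mult_distrib mult_right_mono)
  then have "N \<le> sqrt (max 0 (N\<^sup>2 - \<kappa>))"
    unfolding N_def by (intro norm_operator_le) (auto intro: power2_le_imp_le)
  then have "N\<^sup>2 \<le> max 0 (N\<^sup>2 - \<kappa>)"
    using \<open>0 < N\<close> by (metis less_imp_le max.cobounded1 power_mono real_sqrt_pow2)
  then show False
    using \<open>0 < N\<close> \<open>0 < \<kappa>\<close> by (simp add: max_def split: if_splits)
qed


section \<open>Polynomials of an operator and the spectral norm bound\<close>

definition peval :: "real poly \<Rightarrow> 'a::complex_hilbert_space operator \<Rightarrow> 'a operator"
  where "peval p T = (\<Sum>i\<le>degree p. coeff p i *\<^sub>R T ^ i)"

lemma peval_0 [simp]: "peval 0 T = 0"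
  by (simp add: peval_def)

lemma peval_pCons [simp]: "peval (pCons a p) T = a *\<^sub>R 1 + T * peval p T"
proof (cases "p = 0")
  case False
  then show ?thesis
    by (simp add: peval_def sum.atMost_Suc_shift sum_distrib_left del: sum.atMost_Suc)
qed (simp add: peval_def)

lemma peval_add [simp]: "peval (p + q) T = peval p T + peval q T"
  by (induct p q rule: poly_induct2) (simp_all add: algebra_simps)

lemma peval_smult [simp]: "peval (smult a p) T = a *\<^sub>R peval p T"
  by (induct p) (simp_all add: algebra_simps)

lemma peval_diff [simp]: "peval (p - q) T = peval p T - peval q T"
  using peval_add[of p "smult (-1) q" T] peval_smult[of "-1" q T] by (simp del: peval_add)

lemma peval_mult [simp]: "peval (p * q) T = peval p T * peval q T"
  by (induct p) (simp_all add: algebra_simps)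

lemma peval_commute: "T * peval p T = peval p T * T"
proof (induct p)
  case (pCons a p)
  then show ?case
    by (simp add: distrib_left distrib_right flip: mult.assoc)
qed simp

lemma symmetric_peval:
  assumes "symmetric T" shows "symmetric (peval p T)"
proof (induct p)
  case (pCons a p)
  then have "symmetric (T * peval p T)"
    by (intro symmetric_mult_commute assms peval_commute)
  then show ?case
    by simp
qed simp

text \<open>Only real points of the spectrum enter the functional calculus of a symmetric operator.\<close>

definition real_spectrum :: "'a::complex_hilbert_space operator \<Rightarrow> real set"
  where "real_spectrum T = {t. \<not> unit_op (T - t *\<^sub>R 1)}"

text \<open>A complex root \<open>z\<close> of a real polynomial is real or comes with its conjugate.\<close>

lemma real_poly_dvd_linear_or_quadratic:
  fixes q :: "real poly"
  assumes "degree q > 0"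
  obtains a p where "q = [:-a, 1:] * p"
    | a b p where "b \<noteq> 0" "q = [:a\<^sup>2 + b\<^sup>2, -2 * a, 1:] * p"
proof -
  let ?C = "map_poly complex_of_real"
  have C_pCons: "?C (pCons a p) = pCons (complex_of_real a) (?C p)" for a p
    by (simp add: map_poly_pCons)
  have C_add: "poly (?C (p + r)) z = poly (?C p) z + poly (?C r) z" for p r z
    by (induct p r rule: poly_induct2) (simp_all add: C_pCons algebra_simps)
  have C_smult: "poly (?C (smult a p)) z = a * poly (?C p) z" for a p z
    by (induct p) (simp_all add: C_pCons algebra_simps)
  have C_mult: "poly (?C (p * r)) z = poly (?C p) z * poly (?C r) z" for p r z
    by (induct p) (simp_all add: C_pCons C_add C_smult algebra_simps)
  have "degree (?C q) > 0"
    using assms by (simp add: degree_map_poly)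
  then obtain z where z: "poly (?C q) z = 0"
    using fundamental_theorem_of_algebra_alt[of "?C q"] by fastforce
  show thesis
  proof (cases "Im z = 0")
    case True
    then have "z = complex_of_real (Re z)"
      by (simp add: complex_eq_iff)
    moreover have "poly (?C p) (complex_of_real x) = complex_of_real (poly p x)" for p x
      by (induct p) (simp_all add: C_pCons)
    ultimately have "poly q (Re z) = 0"
      using z by (metis of_real_eq_0_iff)
    then show thesis
      using that(1) by (metis dvdE poly_eq_0_iff_dvd)
  next
    case False
    let ?d = "[:(Re z)\<^sup>2 + (Im z)\<^sup>2, -2 * Re z, 1:]"
    have "poly (?C ?d) z = 0"
      by (simp add: C_pCons complex_eq_iff power2_eq_square algebra_simps)
    moreover have "poly (?C q) z = poly (?C (q div ?d)) z * poly (?C ?d) z + poly (?C (q mod ?d)) z"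
      unfolding C_mult[symmetric] C_add[symmetric] by (simp only: div_mult_mod_eq)
    ultimately have "poly (?C (q mod ?d)) z = 0"
      using z by simp
    moreover have "degree (q mod ?d) < 2"
      using degree_mod_less[of ?d q] by auto
    then have "q mod ?d = [:coeff (q mod ?d) 0, coeff (q mod ?d) 1:]"
      by (intro poly_eqI) (simp add: coeff_pCons coeff_eq_0 split: nat.split)
    then obtain u v where uv: "q mod ?d = [:u, v:]"
      by blast
    ultimately have "complex_of_real u + z * complex_of_real v = 0"
      by (simp add: C_pCons)
    then have "v = 0" "u = 0"
      using False by (auto simp: complex_eq_iff)
    then have "?d dvd q"
      using uv by (simp add: mod_eq_0_iff_dvd)
    then show thesis
      using that(2)[OF False] by (metis dvdE)
  qed
qed

text \<open>
  Over the reals a polynomial splits into linear factors, which are invertible at \<open>T\<close> off the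
  spectrum, and quadratic ones without real root, which at a symmetric operator are bounded
  below: \<open>(T - a)\<^sup>2 + b\<^sup>2 \<ge> b\<^sup>2\<close>.
\<close>

lemma unit_op_peval:
  fixes T :: "'a::complex_hilbert_space operator"
  assumes "symmetric T"
  shows "q \<noteq> 0 \<Longrightarrow> (\<forall>t\<in>real_spectrum T. poly q t \<noteq> 0) \<Longrightarrow> unit_op (peval q T)"
proof (induct "degree q" arbitrary: q rule: less_induct)
  case less
  show ?case
  proof (cases "degree q = 0")
    case True
    then obtain c where "q = [:c:]"
      by (rule degree_eq_zeroE)
    then have "peval q T = c *\<^sub>R 1" "c \<noteq> 0"
      using less.prems by auto
    moreover have "unit_op (1 :: 'a operator)"
      by (auto simp: unit_op_def)
    ultimately show ?thesis
      by (simp only: unit_op_scaleR not_False_eq_True)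
  next
    case False
    then have "degree q > 0" by simp
    then show ?thesis
    proof (cases rule: real_poly_dvd_linear_or_quadratic)
      case (1 a p)
      then have "p \<noteq> 0" using less.prems by auto
      have "unit_op (peval p T)"
      proof (rule less.hyps)
        show "degree p < degree q"
          using \<open>p \<noteq> 0\<close> by (simp add: 1 degree_mult_eq del: mult_pCons_left)
      qed (use 1 less.prems \<open>p \<noteq> 0\<close> in auto)
      moreover have "unit_op (peval [:-a, 1:] T)"
        using less.prems(2) 1 by (auto simp: real_spectrum_def)
      ultimately show ?thesis
        unfolding 1 peval_mult by (intro unit_op_mult)
    next
      case (2 a b p)
      let ?d = "[:a\<^sup>2 + b\<^sup>2, -2 * a, 1:]"
      have "p \<noteq> 0" using less.prems 2 by auto
      have "unit_op (peval p T)"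
      proof (rule less.hyps)
        show "degree p < degree q"
          using \<open>p \<noteq> 0\<close> by (simp add: 2 degree_mult_eq del: mult_pCons_left)
      qed (use 2 less.prems \<open>p \<noteq> 0\<close> in auto)
      moreover have "unit_op (peval ?d T)"
      proof (rule strictly_pos_imp_unit_op)
        have "0 \<le> (T - a *\<^sub>R 1) * (T - a *\<^sub>R 1)"
          using assms by (intro square_nonneg) simp
        moreover have "peval ?d T = b\<^sup>2 *\<^sub>R 1 + (T - a *\<^sub>R 1) * (T - a *\<^sub>R 1)"
          by (simp add: algebra_simps power2_eq_square flip: scaleR_2)
        ultimately show "b\<^sup>2 *\<^sub>R 1 \<le> peval ?d T"
          by simp
      qed (use 2 in simp)
      ultimately show ?thesis
        unfolding 2 peval_mult by (intro unit_op_mult)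
    qed
  qed
qed

lemma real_spectrum_empty_imp_trivial:
  fixes T :: "'a::complex_hilbert_space operator"
  assumes "symmetric T" "real_spectrum T = {}"
  shows "(1 :: 'a operator) = 0"
proof (cases "T = 0")
  case True
  moreover have "0 \<notin> real_spectrum T"
    using assms by simp
  ultimately have "unit_op (0 :: 'a operator)"
    by (simp add: real_spectrum_def)
  then show ?thesis
    by (auto simp: unit_op_def)
next
  case False
  have "unit_op (peval [:(norm T)\<^sup>2, 0, -1:] T)"
    using assms by (intro unit_op_peval) auto
  then show ?thesis
    using not_unit_op_norm[OF assms(1) False] by simp
qed

text \<open>
  This bound makes the functional calculus well defined. If \<open>N = \<parallel>p(T)\<parallel>\<close> exceeded \<open>e\<close>, then
  \<open>N\<^sup>2 - p\<^sup>2\<close> would have no zero on the spectrum, so \<open>N\<^sup>2 - p(T)\<^sup>2\<close> would be invertible,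
  contrary to \<open>not_unit_op_norm\<close>.
\<close>

lemma norm_peval_le:
  fixes T :: "'a::complex_hilbert_space operator"
  assumes "symmetric T" "0 \<le> e" and bound: "\<And>t. t \<in> real_spectrum T \<Longrightarrow> \<bar>poly p t\<bar> \<le> e"
  shows "norm (peval p T) \<le> e"
proof (rule ccontr)
  define N where "N = norm (peval p T)"
  define q where "q = [:N\<^sup>2:] - p * p"
  assume "\<not> norm (peval p T) \<le> e"
  then have "e < N" by (simp add: N_def)
  then have pos: "0 < poly q t" if "t \<in> real_spectrum T" for t
    using bound[OF that] abs_square_less_1 power_strict_mono[of "\<bar>poly p t\<bar>" N 2]
    by (simp add: q_def power2_eq_square)
  have "peval p T \<noteq> 0"
    using \<open>e < N\<close> \<open>0 \<le> e\<close> by (auto simp: N_def)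
  have "q \<noteq> 0"
  proof
    assume "q = 0"
    then have "real_spectrum T = {}"
      using pos by fastforce
    then have "(1 :: 'a operator) = 0"
      by (rule real_spectrum_empty_imp_trivial[OF assms(1)])
    then have "peval p T = 0"
      by (metis mult_1_left mult_zero_left)
    then show False
      using \<open>peval p T \<noteq> 0\<close> by blast
  qed
  moreover have "\<forall>t\<in>real_spectrum T. poly q t \<noteq> 0"
    using pos by fastforce
  ultimately have "unit_op (peval q T)"
    by (rule unit_op_peval[OF assms(1)])
  moreover have "peval q T = N\<^sup>2 *\<^sub>R 1 - peval p T * peval p T"
    by (simp add: q_def)
  ultimately show False
    using not_unit_op_norm[OF symmetric_peval[OF assms(1)] \<open>peval p T \<noteq> 0\<close>] by (simp add: N_def)
qed

lemma real_spectrum_subset: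
  assumes "m *\<^sub>R 1 \<le> T" "T \<le> M *\<^sub>R 1"
  shows "real_spectrum T \<subseteq> {m..M}"
proof
  fix t assume t: "t \<in> real_spectrum T"
  show "t \<in> {m..M}"
  proof (rule ccontr)
    assume "t \<notin> {m..M}"
    then consider "t < m" | "M < t" by fastforce
    then have "unit_op (T - t *\<^sub>R 1)"
    proof cases
      case 1
      have "m *\<^sub>R 1 - t *\<^sub>R 1 \<le> T - t *\<^sub>R 1"
        using assms(1) by (rule diff_right_mono)
      then show ?thesis
        using 1 by (intro strictly_pos_imp_unit_op[of "m - t"]) (simp_all add: scaleR_diff_left)
    next
      case 2
      have "t *\<^sub>R 1 - M *\<^sub>R 1 \<le> t *\<^sub>R 1 - T"
        using assms(2) by (rule diff_left_mono)
      then have "unit_op (t *\<^sub>R 1 - T)"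
        using 2 by (intro strictly_pos_imp_unit_op[of "t - M"]) (simp_all add: scaleR_diff_left)
      then show ?thesis
        using unit_op_scaleR[of "t *\<^sub>R 1 - T" "-1"] by simp
    qed
    with t show False
      by (simp add: real_spectrum_def)
  qed
qed


section \<open>Continuous functional calculus\<close>

text \<open>
  A relation rather than a function: compatibility with the algebraic operations can then be
  stated before existence is known, and a value obtained by algebra is identified by uniqueness.
\<close>

definition has_calculus ::
    "(real \<Rightarrow> real) \<Rightarrow> 'a::complex_hilbert_space operator \<Rightarrow> 'a operator \<Rightarrow> bool"
  where "has_calculus f T S \<longleftrightarrow> (\<exists>p.
    uniform_limit (real_spectrum T) (\<lambda>n. poly (p n)) f sequentially \<and>
    (\<lambda>n. peval (p n) T) \<longlonglongrightarrow> S)"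

lemma has_calculus_poly: "has_calculus (poly p) T (peval p T)"
  unfolding has_calculus_def by (rule exI[of _ "\<lambda>_. p"]) (simp add: uniform_limit_const)

lemma has_calculus_add:
  assumes "has_calculus f T S" "has_calculus g T U"
  shows "has_calculus (\<lambda>t. f t + g t) T (S + U)"
proof -
  obtain p q where *:
    "uniform_limit (real_spectrum T) (\<lambda>n. poly (p n)) f sequentially" "(\<lambda>n. peval (p n) T) \<longlonglongrightarrow> S"
    "uniform_limit (real_spectrum T) (\<lambda>n. poly (q n)) g sequentially" "(\<lambda>n. peval (q n) T) \<longlonglongrightarrow> U"
    using assms by (auto simp: has_calculus_def)
  show ?thesis
    unfolding has_calculus_def
    using uniform_limit_add[OF *(1,3)] tendsto_add[OF *(2,4)]
    by (intro exI[of _ "\<lambda>n. p n + q n"]) (simp add: poly_add[abs_def])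
qed

lemma real_spectrum_bounded:
  assumes "symmetric T" shows "real_spectrum T \<subseteq> {- norm T..norm T}"
proof (rule real_spectrum_subset)
  have "- T \<le> norm T *\<^sub>R 1"
    using symmetric_le_norm[of "- T"] assms by simp
  then show "- norm T *\<^sub>R 1 \<le> T"
    by (simp add: minus_le_iff)
qed (rule symmetric_le_norm[OF assms])

lemma has_calculus_imp_bounded:
  assumes "symmetric T" "has_calculus f T S"
  shows "bounded (f ` real_spectrum T)"
proof -
  obtain p where "uniform_limit (real_spectrum T) (\<lambda>n. poly (p n)) f sequentially"
    using assms(2) by (auto simp: has_calculus_def)
  then have "\<forall>\<^sub>F n in sequentially. \<forall>t\<in>real_spectrum T. dist (poly (p n) t) (f t) < 1"
    by (rule uniform_limitD) simp
  then obtain n where n: "dist (poly (p n) t) (f t) < 1" if "t \<in> real_spectrum T" for t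
    unfolding eventually_sequentially by blast
  have "bounded (poly (p n) ` {- norm T..norm T})"
    by (intro compact_imp_bounded compact_continuous_image continuous_intros) auto
  then obtain B where B: "\<bar>poly (p n) t\<bar> \<le> B" if "t \<in> {- norm T..norm T}" for t
    unfolding bounded_iff real_norm_def by blast
  have "\<bar>f t\<bar> \<le> B + 1" if "t \<in> real_spectrum T" for t
    using n[OF that] B[of t] real_spectrum_bounded[OF assms(1)] that by (auto simp: dist_real_def)
  then show ?thesis
    by (auto simp: bounded_iff)
qed

lemma has_calculus_mult:
  assumes "symmetric T" "has_calculus f T S" "has_calculus g T U"
  shows "has_calculus (\<lambda>t. f t * g t) T (S * U)"
proof -
  obtain p q where *:
    "uniform_limit (real_spectrum T) (\<lambda>n. poly (p n)) f sequentially" "(\<lambda>n. peval (p n) T) \<longlonglongrightarrow> S"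
    "uniform_limit (real_spectrum T) (\<lambda>n. poly (q n)) g sequentially" "(\<lambda>n. peval (q n) T) \<longlonglongrightarrow> U"
    using assms by (auto simp: has_calculus_def)
  have "uniform_limit (real_spectrum T) (\<lambda>n t. poly (p n) t * poly (q n) t) (\<lambda>t. f t * g t)
      sequentially"
    using *(1,3) assms by (intro uniform_lim_mult has_calculus_imp_bounded)
  then show ?thesis
    unfolding has_calculus_def
    using tendsto_mult[OF *(2,4)]
    by (intro exI[of _ "\<lambda>n. p n * q n"]) (simp add: poly_mult[abs_def])
qed

lemma has_calculus_norm_le:
  assumes "symmetric T" "has_calculus f T S" "0 \<le> e"
    and bound: "\<And>t. t \<in> real_spectrum T \<Longrightarrow> \<bar>f t\<bar> \<le> e"
  shows "norm S \<le> e"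
proof (rule field_le_epsilon)
  fix \<epsilon> :: real assume "0 < \<epsilon>"
  obtain p where p: "uniform_limit (real_spectrum T) (\<lambda>n. poly (p n)) f sequentially"
      "(\<lambda>n. peval (p n) T) \<longlonglongrightarrow> S"
    using assms(2) by (auto simp: has_calculus_def)
  have "\<forall>\<^sub>F n in sequentially. \<forall>t\<in>real_spectrum T. dist (poly (p n) t) (f t) < \<epsilon>"
    using p(1) \<open>0 < \<epsilon>\<close> by (rule uniform_limitD)
  then have "\<forall>\<^sub>F n in sequentially. norm (peval (p n) T) \<le> e + \<epsilon>"
  proof eventually_elim
    case (elim n)
    have "\<bar>poly (p n) t\<bar> \<le> e + \<epsilon>" if "t \<in> real_spectrum T" for t
      using elim bound[OF that] that by (fastforce simp: dist_real_def)
    then show ?case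
      using assms(1,3) \<open>0 < \<epsilon>\<close> by (intro norm_peval_le) auto
  qed
  with tendsto_norm[OF p(2)] show "norm S \<le> e + \<epsilon>"
    by (intro tendsto_upperbound[where F = sequentially]) auto
qed

lemma has_calculus_scaleR:
  assumes "symmetric T" "has_calculus f T S"
  shows "has_calculus (\<lambda>t. r * f t) T (r *\<^sub>R S)"
  using has_calculus_mult[OF assms(1) has_calculus_poly[of "[:r:]" T] assms(2)] by simp

lemma has_calculus_diff:
  assumes "symmetric T" "has_calculus f T S" "has_calculus g T U"
  shows "has_calculus (\<lambda>t. f t - g t) T (S - U)"
  using has_calculus_add[OF assms(2) has_calculus_scaleR[OF assms(1,3), of "-1"]] by simp

lemma has_calculus_cong:
  assumes "has_calculus f T S" "\<And>t. t \<in> real_spectrum T \<Longrightarrow> f t = g t"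
  shows "has_calculus g T S"
proof -
  have "uniform_limit (real_spectrum T) h f sequentially
      = uniform_limit (real_spectrum T) h g sequentially" for h :: "nat \<Rightarrow> real \<Rightarrow> real"
    using assms(2) by (intro uniform_limit_cong) auto
  then show ?thesis
    using assms(1) by (simp add: has_calculus_def)
qed

lemma has_calculus_unique:
  assumes "symmetric T" "has_calculus f T S" "has_calculus f T U"
  shows "S = U"
  using has_calculus_norm_le[OF assms(1) has_calculus_diff[OF assms], of 0] by simp

lemma symmetric_has_calculus:
  assumes "symmetric T" "has_calculus f T S" shows "symmetric S"
proof -
  obtain p where "(\<lambda>n. peval (p n) T) \<longlonglongrightarrow> S"
    using assms(2) by (auto simp: has_calculus_def)
  then show ?thesis
    by (rule symmetric_limit[rotated]) (rule symmetric_peval[OF assms(1)])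
qed

lemma has_calculus_exists:
  assumes "symmetric T" "real_spectrum T \<subseteq> {m..M}" "continuous_on {m..M} f"
  obtains S where "has_calculus f T S"
proof -
  obtain g where g: "uniform_limit {m..M} g f sequentially" "\<And>n. polynomial_function (g n)"
    using Stone_Weierstrass_uniform_limit[OF _ assms(3)] by auto
  have "\<exists>p. g n = poly p" for n
  proof -
    obtain a k where "g n = (\<lambda>x. \<Sum>i\<le>k. a i * x ^ i)"
      using g(2)[of n] real_polynomial_function_iff_sum by (auto simp: real_polynomial_function_eq)
    then have "g n = poly (\<Sum>i\<le>k. monom (a i) i)"
      by (simp add: poly_sum poly_monom fun_eq_iff)
    then show ?thesis by blast
  qed
  then obtain p where p: "g n = poly (p n)" for n
    by metis
  have unif: "uniform_limit (real_spectrum T) (\<lambda>n. poly (p n)) f sequentially"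
    using uniform_limit_on_subset[OF g(1) assms(2)] by (simp flip: p)
  have "Cauchy (\<lambda>n. peval (p n) T)"
  proof (rule metric_CauchyI)
    fix e :: real assume "0 < e"
    then have "\<forall>\<^sub>F n in sequentially. \<forall>t\<in>real_spectrum T. dist (poly (p n) t) (f t) < e / 4"
      by (intro uniform_limitD[OF unif]) simp
    then obtain N where N: "dist (poly (p n) t) (f t) < e / 4"
      if "n \<ge> N" "t \<in> real_spectrum T" for n t
      unfolding eventually_sequentially by blast
    have "dist (peval (p n) T) (peval (p k) T) < e" if "n \<ge> N" "k \<ge> N" for n k
    proof -
      have "\<bar>poly (p n - p k) t\<bar> \<le> e / 2" if "t \<in> real_spectrum T" for t
        using N[OF \<open>n \<ge> N\<close> that] N[OF \<open>k \<ge> N\<close> that] unfolding dist_real_def poly_diff by linarith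
      then have "norm (peval (p n - p k) T) \<le> e / 2"
        using assms(1) \<open>0 < e\<close> by (intro norm_peval_le) auto
      then show ?thesis
        using \<open>0 < e\<close> by (simp add: dist_norm)
    qed
    then show "\<exists>N. \<forall>n\<ge>N. \<forall>k\<ge>N. dist (peval (p n) T) (peval (p k) T) < e"
      by blast
  qed
  then obtain S where "(\<lambda>n. peval (p n) T) \<longlonglongrightarrow> S"
    using Cauchy_convergent convergent_def by blast
  then show thesis
    using that unif unfolding has_calculus_def by blast
qed

lemma blinfun_of_eqs:
  "blinfun_of (S + T) = blinfun_of S + blinfun_of T"
  "blinfun_of (S - T) = blinfun_of S - blinfun_of T"
  "blinfun_of (S * T) = blinfun_of S o\<^sub>L blinfun_of T"
  "blinfun_of (r *\<^sub>R T) = r *\<^sub>R blinfun_of T"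
  "blinfun_of 1 = id_blinfun"
  by (transfer; simp)+

lemma bounded_op_blinfun_of: "bounded_op (blinfun_of T)"
  using blinfun_of[of T] by simp

lemma invertible_op_blinfun_of: "invertible_op (blinfun_of T) \<longleftrightarrow> unit_op T"
proof
  assume "invertible_op (blinfun_of T)"
  then obtain S where "bounded_op S" "S o\<^sub>L blinfun_of T = id_blinfun" "blinfun_of T o\<^sub>L S = id_blinfun"
    by (auto simp: invertible_op_def)
  then have "Operator S * T = 1" "T * Operator S = 1"
    by (simp_all add: Operator_inverse blinfun_of_eqs flip: blinfun_of_inject)
  then show "unit_op T"
    by (auto simp: unit_op_def)
next
  assume "unit_op T"
  then obtain S where "S * T = 1" "T * S = 1"
    by (auto simp: unit_op_def)
  then show "invertible_op (blinfun_of T)"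
    unfolding invertible_op_def
    by (intro exI[of _ "blinfun_of S"]) (simp add: bounded_op_blinfun_of flip: blinfun_of_eqs)
qed

lemma spectrum_blinfun_of:
  fixes T :: "'a::complex_hilbert_space operator"
  shows "{t. complex_of_real t \<in> spectrum (blinfun_of T)} = real_spectrum T"
proof -
  have "scalar_op (complex_of_real t) = blinfun_of (t *\<^sub>R (1 :: 'a operator))" for t
    by (rule blinfun_eqI) (simp add: scalar_op.rep_eq scaleC_of_real blinfun_of_eqs blinfun.scaleR_left)
  then show ?thesis
    by (simp add: spectrum_def real_spectrum_def invertible_op_blinfun_of flip: blinfun_of_eqs)
qed

lemma poly_op_blinfun_of:
  fixes T :: "'a::complex_hilbert_space operator"
  shows "poly_op p (blinfun_of T) = blinfun_of (peval p T)"
proof -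
  have "((o\<^sub>L) (blinfun_of T) ^^ i) id_blinfun = blinfun_of (T ^ i)" for i
    by (induct i) (simp_all add: blinfun_of_eqs)
  moreover have "blinfun_of (\<Sum>i\<in>I. f i) = (\<Sum>i\<in>I. blinfun_of (f i))" if "finite I"
    for I :: "nat set" and f :: "nat \<Rightarrow> 'a operator"
    using that by (induct I) (simp_all add: blinfun_of_eqs zero_operator.rep_eq)
  ultimately show ?thesis
    by (simp add: poly_op_def peval_def blinfun_of_eqs)
qed

text \<open>
  A competing limit \<open>R\<close> is not known to be complex linear; it is, because the approximating
  polynomials already form a Cauchy sequence in the algebra, which is complete.
\<close>

lemma fun_calc_blinfun_of:
  assumes "symmetric T" "has_calculus f T S"
  shows "fun_calc f (blinfun_of T) = blinfun_of S"
  unfolding fun_calc_def spectrum_blinfun_of poly_op_blinfun_of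
proof (rule the_equality)
  show "\<exists>p. uniform_limit (real_spectrum T) (\<lambda>n. poly (p n)) f sequentially \<and>
      (\<lambda>n. blinfun_of (peval (p n) T)) \<longlonglongrightarrow> blinfun_of S"
    using assms(2) by (simp add: has_calculus_def tendsto_blinfun_of)
next
  fix R
  assume "\<exists>p. uniform_limit (real_spectrum T) (\<lambda>n. poly (p n)) f sequentially \<and>
      (\<lambda>n. blinfun_of (peval (p n) T)) \<longlonglongrightarrow> R"
  then obtain p where p: "uniform_limit (real_spectrum T) (\<lambda>n. poly (p n)) f sequentially"
    "(\<lambda>n. blinfun_of (peval (p n) T)) \<longlonglongrightarrow> R"
    by blast
  have "Cauchy (\<lambda>n. peval (p n) T)"
    using LIMSEQ_imp_Cauchy[OF p(2)] by (simp add: Cauchy_def dist_blinfun_of)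
  then obtain U where U: "(\<lambda>n. peval (p n) T) \<longlonglongrightarrow> U"
    using Cauchy_convergent convergent_def by blast
  then have "R = blinfun_of U"
    using p(2) by (metis LIMSEQ_unique tendsto_blinfun_of)
  moreover have "U = S"
    using p(1) U assms by (intro has_calculus_unique[of T f]) (auto simp: has_calculus_def)
  ultimately show "R = blinfun_of S"
    by simp
qed


section \<open>Positive invertible operators\<close>

text \<open>
  A positive lower bound amounts to positivity and invertibility together, and unlike
  invertibility it passes visibly to sums and to larger operators.
\<close>

definition positive_invertible :: "'a::complex_hilbert_space operator \<Rightarrow> bool"
  where "positive_invertible T \<longleftrightarrow> (\<exists>m>0. m *\<^sub>R 1 \<le> T)"

lemma one_nonneg: "0 \<le> (1 :: 'a::complex_hilbert_space operator)"
  by (rule operator_leI) auto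

lemma positive_invertible_mono: "positive_invertible S \<Longrightarrow> S \<le> T \<Longrightarrow> positive_invertible T"
  unfolding positive_invertible_def by (meson order_trans)

lemma positive_invertible_imp_nonneg: "positive_invertible T \<Longrightarrow> 0 \<le> T"
  unfolding positive_invertible_def
  by (meson less_imp_le one_nonneg order_trans scaleR_nonneg_nonneg)

lemma positive_invertible_imp_symmetric: "positive_invertible T \<Longrightarrow> symmetric T"
  by (intro nonneg_imp_symmetric positive_invertible_imp_nonneg)

lemma positive_invertible_one: "positive_invertible 1"
  unfolding positive_invertible_def by (rule exI[of _ 1]) simp

lemma positive_invertible_scaleR:
  "positive_invertible T \<Longrightarrow> 0 < r \<Longrightarrow> positive_invertible (r *\<^sub>R T)"
  unfolding positive_invertible_def
  by (metis less_imp_le mult_pos_pos scaleR_left_mono scaleR_scaleR)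

lemma positive_invertible_combination:
  assumes "positive_invertible S" "positive_invertible T" "0 \<le> a" "0 \<le> b" "0 < a + b"
  shows "positive_invertible (a *\<^sub>R S + b *\<^sub>R T)"
proof (cases "a = 0")
  case True
  then show ?thesis
    using assms by (simp add: positive_invertible_scaleR)
next
  case False
  then have "positive_invertible (a *\<^sub>R S)"
    using assms by (simp add: positive_invertible_scaleR)
  then show ?thesis
    by (rule positive_invertible_mono)
      (use assms in \<open>simp add: scaleR_nonneg_nonneg positive_invertible_imp_nonneg\<close>)
qed

text \<open>
  The bounds are common to a finite family because one approximating sequence of functions has to
  serve a convex combination and its two end points.
\<close>

lemma positive_invertible_bounds:
  fixes T :: "'i \<Rightarrow> 'a::complex_hilbert_space operator"
  assumes "finite I" "\<And>i. i \<in> I \<Longrightarrow> positive_invertible (T i)"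
  obtains m M where "0 < m" "m \<le> M" "\<forall>i\<in>I. m *\<^sub>R 1 \<le> T i \<and> T i \<le> M *\<^sub>R 1"
proof -
  have "\<exists>m M. 0 < m \<and> m \<le> M \<and> (\<forall>i\<in>I. m *\<^sub>R 1 \<le> T i \<and> T i \<le> M *\<^sub>R 1)"
    using assms
  proof (induct I)
    case empty
    then show ?case by (auto intro: exI[of _ 1])
  next
    case (insert j I)
    then obtain m M where IH: "0 < m" "m \<le> M" "\<And>i. i \<in> I \<Longrightarrow> m *\<^sub>R 1 \<le> T i \<and> T i \<le> M *\<^sub>R 1"
      by blast
    obtain \<mu> where \<mu>: "0 < \<mu>" "\<mu> *\<^sub>R 1 \<le> T j"
      using insert.prems by (auto simp: positive_invertible_def)
    have "T j \<le> norm (T j) *\<^sub>R 1"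
      using insert.prems by (intro symmetric_le_norm positive_invertible_imp_symmetric) auto
    moreover have mono: "r *\<^sub>R 1 \<le> s *\<^sub>R (1 :: 'a operator)" if "r \<le> s" for r s
      using that one_nonneg by (rule scaleR_right_mono)
    ultimately have "min m \<mu> *\<^sub>R 1 \<le> T j" "T j \<le> max M (norm (T j)) *\<^sub>R 1"
      using \<mu>(2) by (meson max.cobounded2 min.cobounded2 order_trans)+
    moreover have "min m \<mu> *\<^sub>R 1 \<le> T i" "T i \<le> max M (norm (T j)) *\<^sub>R 1" if "i \<in> I" for i
      using IH(3)[OF that] mono by (meson max.cobounded1 min.cobounded1 order_trans)+
    ultimately have "\<forall>i\<in>insert j I. min m \<mu> *\<^sub>R 1 \<le> T i \<and> T i \<le> max M (norm (T j)) *\<^sub>R 1"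
      by blast
    moreover have "0 < min m \<mu>" "min m \<mu> \<le> max M (norm (T j))"
      using IH(1,2) \<mu>(1) by auto
    ultimately show ?case by blast
  qed
  then show thesis
    using that by blast
qed

text \<open>
  For \<open>T\<close> positive and invertible the spectrum lies in a compact subinterval of the open half-line,
  so every function that is continuous there has a value.
\<close>

definition fcalc :: "(real \<Rightarrow> real) \<Rightarrow> 'a::complex_hilbert_space operator \<Rightarrow> 'a operator"
  where "fcalc f T = (THE S. has_calculus f T S)"

lemma fcalc_eqI:
  "positive_invertible T \<Longrightarrow> has_calculus f T S \<Longrightarrow> fcalc f T = S"
  unfolding fcalc_def
  by (metis has_calculus_unique positive_invertible_imp_symmetric the_equality)

context
  fixes T :: "'a::complex_hilbert_space operator"
  assumes pos: "positive_invertible T"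
begin

lemma real_spectrum_bounds:
  obtains m M where "0 < m" "m \<le> M" "real_spectrum T \<subseteq> {m..M}"
proof -
  obtain m M where *: "0 < m" "m \<le> M" "m *\<^sub>R 1 \<le> T" "T \<le> M *\<^sub>R 1"
    using positive_invertible_bounds[of "{()}" "\<lambda>_. T"] pos by (metis finite.simps singletonI)
  then show thesis
    using that[OF *(1,2)] real_spectrum_subset by blast
qed

lemma has_calculus_fcalc:
  assumes "continuous_on {0<..} f" shows "has_calculus f T (fcalc f T)"
proof -
  obtain m M where m: "0 < m" "real_spectrum T \<subseteq> {m..M}"
    by (rule real_spectrum_bounds)
  moreover have "continuous_on {m..M} f"
    using \<open>0 < m\<close> by (intro continuous_on_subset[OF assms]) auto
  ultimately obtain S where "has_calculus f T S"
    using has_calculus_exists pos positive_invertible_imp_symmetric by blast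
  then show ?thesis
    using fcalc_eqI pos by metis
qed

lemma fcalc_cong: "(\<And>t. 0 < t \<Longrightarrow> f t = g t) \<Longrightarrow> continuous_on {0<..} f \<Longrightarrow> fcalc f T = fcalc g T"
proof -
  assume "\<And>t. 0 < t \<Longrightarrow> f t = g t" "continuous_on {0<..} f"
  moreover obtain m M where "0 < m" "real_spectrum T \<subseteq> {m..M}"
    by (rule real_spectrum_bounds)
  ultimately have "has_calculus g T (fcalc f T)"
    by (intro has_calculus_cong[OF has_calculus_fcalc]) auto
  then show ?thesis
    by (simp add: fcalc_eqI pos)
qed

lemma symmetric_fcalc: "continuous_on {0<..} f \<Longrightarrow> symmetric (fcalc f T)"
  using symmetric_has_calculus has_calculus_fcalc pos positive_invertible_imp_symmetric by blast

lemma fcalc_mult: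
  "continuous_on {0<..} f \<Longrightarrow> continuous_on {0<..} g \<Longrightarrow>
    fcalc (\<lambda>t. f t * g t) T = fcalc f T * fcalc g T"
  by (intro fcalc_eqI pos has_calculus_mult has_calculus_fcalc positive_invertible_imp_symmetric)

lemma fcalc_linear: "fcalc (\<lambda>t. a * t + b) T = a *\<^sub>R T + b *\<^sub>R 1"
proof (rule fcalc_eqI[OF pos])
  have "poly [:b, a:] = (\<lambda>t. a * t + b)"
    by (auto simp: fun_eq_iff)
  then show "has_calculus (\<lambda>t. a * t + b) T (a *\<^sub>R T + b *\<^sub>R 1)"
    using has_calculus_poly[of "[:b, a:]" T] by (simp add: add.commute)
qed

lemma fcalc_id: "fcalc (\<lambda>t. t) T = T"
  using fcalc_linear[of 1 0] by simp

lemma fcalc_const: "fcalc (\<lambda>t. b) T = b *\<^sub>R 1"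
  using fcalc_linear[of 0 b] by simp

lemma fcalc_sum:
  "finite K \<Longrightarrow> (\<And>k. k \<in> K \<Longrightarrow> continuous_on {0<..} (f k)) \<Longrightarrow>
    fcalc (\<lambda>t. \<Sum>k\<in>K. f k t) T = (\<Sum>k\<in>K. fcalc (f k) T)"
proof (induct K rule: finite_induct)
  case empty
  then show ?case using fcalc_const[of 0] by simp
next
  case (insert k K)
  have "fcalc (\<lambda>t. f k t + (\<Sum>k\<in>K. f k t)) T = fcalc (f k) T + fcalc (\<lambda>t. \<Sum>k\<in>K. f k t) T"
    using insert.prems
    by (intro fcalc_eqI pos has_calculus_add has_calculus_fcalc continuous_on_sum) auto
  then show ?case
    using insert by simp
qed

lemma fcalc_dist_le:
  assumes "m *\<^sub>R 1 \<le> T" "T \<le> M *\<^sub>R 1" "continuous_on {0<..} f" "continuous_on {0<..} g" "0 \<le> e"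
    and "\<And>t. t \<in> {m..M} \<Longrightarrow> \<bar>f t - g t\<bar> \<le> e"
  shows "norm (fcalc f T - fcalc g T) \<le> e"
  using assms real_spectrum_subset[OF assms(1,2)] pos positive_invertible_imp_symmetric
  by (intro has_calculus_norm_le[of T "\<lambda>t. f t - g t"] has_calculus_diff has_calculus_fcalc) auto

text \<open>With \<open>f\<^sub>0\<close> the minimum of \<open>f\<close> on an interval around the spectrum, \<open>f - f\<^sub>0\<close> is a square there.\<close>

lemma positive_invertible_fcalc:
  assumes cont: "continuous_on {0<..} f" and f: "\<And>t. 0 < t \<Longrightarrow> 0 < f t"
  shows "positive_invertible (fcalc f T)"
proof -
  obtain m M where m: "0 < m" "m \<le> M" "real_spectrum T \<subseteq> {m..M}"
    by (rule real_spectrum_bounds)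
  then have "continuous_on {m..M} f"
    by (intro continuous_on_subset[OF cont]) auto
  then obtain t0 where t0: "t0 \<in> {m..M}" "\<And>t. t \<in> {m..M} \<Longrightarrow> f t0 \<le> f t"
    using continuous_attains_inf[of "{m..M}" f] m(2) by auto
  define g where "g t = sqrt (max 0 (f t - f t0))" for t
  have g: "continuous_on {0<..} g"
    unfolding g_def by (intro continuous_intros cont)
  have "g t * g t + f t0 = f t" if "t \<in> real_spectrum T" for t
    using t0(2)[of t] m(3) that by (auto simp: g_def)
  then have "has_calculus f T (fcalc g T * fcalc g T + f t0 *\<^sub>R 1)"
    using has_calculus_poly[of "[:f t0:]" T] has_calculus_fcalc[OF g] pos
      positive_invertible_imp_symmetric
    by (intro has_calculus_cong[OF has_calculus_add[OF has_calculus_mult]]) auto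
  then have "fcalc f T = fcalc g T * fcalc g T + f t0 *\<^sub>R 1"
    by (intro fcalc_eqI pos)
  then have "f t0 *\<^sub>R 1 \<le> fcalc f T"
    using square_nonneg[OF symmetric_fcalc[OF g]] by simp
  moreover have "0 < f t0"
    using t0(1) m(1) by (intro f) auto
  ultimately show ?thesis
    by (auto simp: positive_invertible_def)
qed

end


section \<open>Approximating powers by simple fractions\<close>

lemma summable_on_int_geometric:
  fixes r :: real
  assumes "0 \<le> r" "r < 1"
  shows "(\<lambda>k::int. r ^ nat \<bar>k\<bar>) summable_on UNIV"
proof -
  have geom: "(\<lambda>n. r ^ n) summable_on UNIV"
    using assms by (subst summable_on_UNIV_nonneg_real_iff) (auto simp: summable_geometric)
  have "((\<lambda>k::int. r ^ nat \<bar>k\<bar>) \<circ> int) = (\<lambda>n. r ^ n)"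
    by (auto simp: fun_eq_iff)
  then have nonneg: "(\<lambda>k::int. r ^ nat \<bar>k\<bar>) summable_on range int"
    using geom by (subst summable_on_reindex) auto
  have "((\<lambda>k::int. r ^ nat \<bar>k\<bar>) \<circ> (\<lambda>n. - int (Suc n))) = (\<lambda>n. r * r ^ n)"
    by (auto simp: fun_eq_iff nat_add_distrib simp flip: power_Suc)
  then have neg: "(\<lambda>k::int. r ^ nat \<bar>k\<bar>) summable_on range (\<lambda>n. - int (Suc n))"
    using summable_on_cmult_right[OF geom, of r] by (subst summable_on_reindex) (auto simp: inj_def)
  have "k \<in> range int \<union> range (\<lambda>n. - int (Suc n))" for k :: int
    by (cases k rule: int_cases) auto
  then have "range int \<union> range (\<lambda>n. - int (Suc n)) = UNIV"
    by blast
  moreover have "range int \<inter> range (\<lambda>n. - int (Suc n)) = {}"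
    by auto
  ultimately show ?thesis
    using summable_on_Un_disjoint[OF nonneg neg] by simp
qed

text \<open>
  Put \<open>w\<^sub>k(t) = q\<^bsup>\<gamma>k\<^esup> t / (t + q\<^sup>k)\<close> and let \<open>F\<close> be the sum over all integers \<open>k\<close>. Shifting the index
  gives \<open>F(q t) = q\<^sup>\<gamma> F(t)\<close>, and \<open>F\<close> is increasing; so \<open>F(t) / F(1)\<close> agrees with \<open>t\<^sup>\<gamma>\<close> at the powers
  of \<open>q\<close>, and up to the factor \<open>q\<^sup>\<gamma>\<close> everywhere. Let \<open>q\<close> be close to 1 and truncate the sum.
\<close>

lemma powr_approx_open:
  fixes m M \<gamma> e :: real
  assumes "0 < m" "m \<le> M" "0 < \<gamma>" "\<gamma> < 1" "0 < e"
  obtains K :: "int set" and a b :: "int \<Rightarrow> real" where "finite K" "\<And>k. 0 < a k" "\<And>k. 0 < b k"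
    "\<And>t. t \<in> {m..M} \<Longrightarrow> \<bar>t powr \<gamma> - (\<Sum>k\<in>K. t / (a k * t + b k))\<bar> \<le> e"
proof -
  \<comment> \<open>chosen so that the relative error \<open>q\<^sup>\<gamma> - 1 = \<delta>\<close> costs at most \<open>e / 2\<close> on the interval\<close>
  define \<delta> where "\<delta> = e / (2 * M powr \<gamma>)"
  define q where "q = (1 + \<delta>) powr (1 / \<gamma>)"
  have "0 < M" using assms by simp
  have "0 < \<delta>" using assms by (simp add: \<delta>_def)
  have q\<gamma>: "q powr \<gamma> = 1 + \<delta>"
    using \<open>0 < \<delta>\<close> \<open>0 < \<gamma>\<close> by (simp add: q_def powr_powr)
  have "1 < q"
    using \<open>0 < \<delta>\<close> \<open>0 < \<gamma>\<close> by (simp add: q_def)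
  then have "0 < q" by simp
  define w where "w k t = q powr (\<gamma> * of_int k) * (t / (t + q powr of_int k))" for k :: int and t
  \<comment> \<open>\<open>w\<^sub>k(t)\<close> decays like \<open>q\<^bsup>(\<gamma> - 1)k\<^esup>\<close> for large \<open>k\<close> and like \<open>q\<^bsup>\<gamma>k\<^esup>\<close> for very negative \<open>k\<close>\<close>
  define r where "r = max (q powr (\<gamma> - 1)) (q powr (- \<gamma>))"
  have r: "0 \<le> r" "r < 1"
    using \<open>1 < q\<close> \<open>0 < \<gamma>\<close> \<open>\<gamma> < 1\<close> powr_less_cancel_iff[of q _ 0] by (auto simp: r_def max_def)
  have w_bound: "w k t \<le> max 1 t * r ^ nat \<bar>k\<bar>" if "0 < t" for k t
  proof (cases "0 \<le> k")
    case True
    have "w k t \<le> q powr (\<gamma> * of_int k) * (t / q powr of_int k)"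
      unfolding w_def using \<open>0 < q\<close> that
      by (intro mult_left_mono divide_left_mono mult_pos_pos add_pos_pos) auto
    also have "q powr (\<gamma> * of_int k) * (t / q powr of_int k) = t * q powr (\<gamma> * of_int k - of_int k)"
      by (simp add: powr_diff)
    also have "q powr (\<gamma> * of_int k - of_int k) = (q powr (\<gamma> - 1)) ^ nat \<bar>k\<bar>"
      using \<open>0 < q\<close> True by (simp add: powr_realpow[symmetric] powr_powr left_diff_distrib)
    also have "t * (q powr (\<gamma> - 1)) ^ nat \<bar>k\<bar> \<le> max 1 t * r ^ nat \<bar>k\<bar>"
      using that by (intro mult_mono power_mono) (auto simp: r_def)
    finally show ?thesis .
  next
    case False
    have "w k t \<le> q powr (\<gamma> * of_int k) * 1"
      unfolding w_def using that
      by (intro mult_left_mono) (auto simp: divide_le_eq_1 add_pos_nonneg)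
    also have "\<dots> = 1 * (q powr (- \<gamma>)) ^ nat \<bar>k\<bar>"
      using \<open>0 < q\<close> False by (simp add: powr_realpow[symmetric] powr_powr)
    also have "\<dots> \<le> max 1 t * r ^ nat \<bar>k\<bar>"
      using that by (intro mult_mono power_mono) (auto simp: r_def)
    finally show ?thesis .
  qed
  have w_pos: "0 < w k t" if "0 < t" for k t
    using that \<open>0 < q\<close> by (auto simp: w_def intro!: mult_pos_pos divide_pos_pos add_pos_pos)
  then have w_nonneg: "0 \<le> w k t" if "0 < t" for k t
    using that by (simp add: less_imp_le)
  have geom: "(\<lambda>k. C * r ^ nat \<bar>k\<bar>) summable_on UNIV" for C
    by (intro summable_on_cmult_right summable_on_int_geometric r)
  have w_summable: "(\<lambda>k. w k t) summable_on UNIV" if "0 < t" for t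
    using geom[of "max 1 t"] by (rule summable_on_comparison_test)
      (use that w_bound w_nonneg in auto)
  define F where "F t = (\<Sum>\<^sub>\<infinity>k. w k t)" for t
  define c where "c = F 1"
  have F_pos: "0 < F t" if "0 < t" for t
  proof -
    have "sum (\<lambda>k. w k t) {0} \<le> F t"
      unfolding F_def using that w_summable w_nonneg by (intro finite_sum_le_infsum) auto
    then show ?thesis
      using w_pos[OF that, of 0] by simp
  qed
  then have "0 < c" by (simp add: c_def)
  have F_mono: "F s \<le> F t" if "0 < s" "s \<le> t" for s t
  proof -
    have "s / (s + x) \<le> t / (t + x)" if "0 < x" for x
      using \<open>0 < s\<close> \<open>s \<le> t\<close> that by (simp add: field_simps)
    then have "w k s \<le> w k t" for k
      unfolding w_def using \<open>0 < q\<close> by (intro mult_left_mono) auto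
    then show ?thesis
      unfolding F_def using that by (intro infsum_mono w_summable) auto
  qed
  have F_shift: "F (q powr of_int j) = q powr (\<gamma> * of_int j) * c" for j :: int
  proof -
    have shift: "w (k + j) (q powr of_int j) = q powr (\<gamma> * of_int j) * w k 1" for k
    proof -
      have "q powr of_int j + q powr of_int (k + j) = q powr of_int j * (1 + q powr of_int k)"
        by (simp add: powr_add algebra_simps)
      then have "q powr of_int j / (q powr of_int j + q powr of_int (k + j)) = 1 / (1 + q powr of_int k)"
        using \<open>0 < q\<close> by simp
      then show ?thesis
        by (simp add: w_def powr_add distrib_left)
    qed
    have "F (q powr of_int j) = (\<Sum>\<^sub>\<infinity>k. w (k + j) (q powr of_int j))"
      unfolding F_def
      by (rule infsum_reindex_bij_betw[symmetric])
        (auto intro!: bij_betwI[of _ _ _ "\<lambda>k. k - j"])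
    also have "\<dots> = q powr (\<gamma> * of_int j) * c"
      unfolding shift c_def F_def by (intro infsum_cmult_right w_summable) simp
    finally show ?thesis .
  qed
  have F_approx: "\<bar>t powr \<gamma> - F t / c\<bar> \<le> e / 2" if "0 < t" "t \<le> M" for t
  proof -
    define j where "j = \<lfloor>log q t\<rfloor>"
    define p where "p = q powr of_int j"
    have "0 < p"
      using \<open>0 < q\<close> by (simp add: p_def)
    have p\<gamma>: "p powr \<gamma> = q powr (\<gamma> * of_int j)"
      by (simp add: p_def powr_powr mult.commute)
    have q_p: "q * p = q powr of_int (j + 1)"
      using \<open>0 < q\<close> by (simp add: p_def powr_add mult.commute)
    have le: "p \<le> t" "t \<le> q * p"
      unfolding q_p using \<open>1 < q\<close> \<open>0 < t\<close>
      by (auto simp: p_def j_def powr_le_iff le_powr_iff intro: less_imp_le)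
    have "F p / c = p powr \<gamma>"
      using F_shift[of j] \<open>0 < c\<close> by (simp add: p\<gamma> flip: p_def)
    moreover have "F (q * p) / c = (q * p) powr \<gamma>"
      using F_shift[of "j + 1"] \<open>0 < c\<close> unfolding q_p by (simp add: powr_powr mult.commute)
    ultimately have "p powr \<gamma> \<le> F t / c" "F t / c \<le> (q * p) powr \<gamma>"
      using F_mono[of p t] F_mono[of t "q * p"] le \<open>0 < p\<close> \<open>0 < t\<close> \<open>0 < c\<close>
      by (metis divide_right_mono less_imp_le)+
    moreover have "p powr \<gamma> \<le> t powr \<gamma>" "t powr \<gamma> \<le> (q * p) powr \<gamma>"
      using le \<open>0 < p\<close> \<open>0 < t\<close> \<open>0 < \<gamma>\<close> by (auto intro: powr_mono2)
    moreover have "(q * p) powr \<gamma> = p powr \<gamma> + \<delta> * p powr \<gamma>"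
      using \<open>0 < q\<close> \<open>0 < p\<close> by (simp add: powr_mult q\<gamma> algebra_simps)
    ultimately have "\<bar>t powr \<gamma> - F t / c\<bar> \<le> \<delta> * p powr \<gamma>"
      by linarith
    also have "\<dots> \<le> \<delta> * M powr \<gamma>"
      using \<open>0 < \<delta>\<close> \<open>0 < p\<close> \<open>0 < \<gamma>\<close> le(1) that(2) by (intro mult_left_mono powr_mono2) auto
    also have "\<dots> = e / 2"
      using \<open>0 < M\<close> by (simp add: \<delta>_def)
    finally show ?thesis .
  qed
  let ?u = "\<lambda>k::int. max 1 M * r ^ nat \<bar>k\<bar>"
  obtain K where K: "finite K" "dist (sum ?u K) (infsum ?u UNIV) \<le> c * e / 2"
    using infsum_finite_approximation[OF geom[of "max 1 M"], of "c * e / 2"] \<open>0 < c\<close> \<open>0 < e\<close> by auto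
  have split: "infsum f UNIV = sum f K + infsum f (- K)" if "f summable_on UNIV"
    for f :: "int \<Rightarrow> real"
    using infsum_Un_disjoint[of f K "- K"] summable_on_subset_banach[OF that] K(1) by simp
  have tail: "\<bar>F t - (\<Sum>k\<in>K. w k t)\<bar> \<le> c * e / 2" if "0 < t" "t \<le> M" for t
  proof -
    have "F t - (\<Sum>k\<in>K. w k t) = (\<Sum>\<^sub>\<infinity>k\<in>-K. w k t)"
      using split[OF w_summable[OF that(1)]] by (simp add: F_def)
    moreover have "0 \<le> (\<Sum>\<^sub>\<infinity>k\<in>-K. w k t)"
      using w_pos[OF that(1)] by (intro infsum_nonneg) (simp add: less_imp_le)
    moreover have "(\<Sum>\<^sub>\<infinity>k\<in>-K. w k t) \<le> infsum ?u (- K)"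
    proof (intro infsum_mono)
      fix k
      have "w k t \<le> max 1 t * r ^ nat \<bar>k\<bar>"
        by (rule w_bound[OF that(1)])
      also have "\<dots> \<le> ?u k"
        using that r by (intro mult_right_mono) auto
      finally show "w k t \<le> ?u k" .
    qed (use summable_on_subset_banach[OF w_summable[OF that(1)]]
          summable_on_subset_banach[OF geom] in auto)
    moreover have "infsum ?u (- K) \<le> c * e / 2"
      using K(2) split[OF geom[of "max 1 M"]] unfolding dist_real_def by linarith
    ultimately show ?thesis by linarith
  qed
  define a where "a k = c * q powr (- \<gamma> * of_int k)" for k :: int
  define b where "b k = c * q powr ((1 - \<gamma>) * of_int k)" for k :: int
  have w_eq: "w k t / c = t / (a k * t + b k)" if "0 < t" for k t
  proof -
    have "a k * t + b k = (c / q powr (\<gamma> * of_int k)) * (t + q powr of_int k)"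
      by (simp add: a_def b_def left_diff_distrib powr_diff powr_minus divide_inverse
          algebra_simps)
    moreover have "u * (t / y) / c = t / ((c / u) * y)" for u y
      by (simp add: mult.commute)
    ultimately show ?thesis
      unfolding w_def by presburger
  qed
  show thesis
  proof (rule that)
    show "finite K" by fact
    show "0 < a k" "0 < b k" for k
      using \<open>0 < c\<close> \<open>0 < q\<close> by (simp_all add: a_def b_def)
    fix t assume "t \<in> {m..M}"
    then have t: "0 < t" "t \<le> M"
      using \<open>0 < m\<close> by auto
    have "(\<Sum>k\<in>K. t / (a k * t + b k)) = (\<Sum>k\<in>K. w k t) / c"
      by (simp add: w_eq[OF t(1)] sum_divide_distrib)
    moreover have "\<bar>F t / c - (\<Sum>k\<in>K. w k t) / c\<bar> \<le> e / 2"
      using tail[OF t] \<open>0 < c\<close> by (simp add: field_simps flip: diff_divide_distrib)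
    ultimately show "\<bar>t powr \<gamma> - (\<Sum>k\<in>K. t / (a k * t + b k))\<bar> \<le> e"
      using F_approx[OF t] by linarith
  qed
qed

text \<open>
  Allowing one of \<open>a\<close>, \<open>b\<close> to vanish covers the end points, as \<open>1 = t / t\<close> and \<open>t = t / 1\<close>.
\<close>

lemma powr_approx:
  fixes m M \<gamma> e :: real
  assumes "0 < m" "m \<le> M" "0 \<le> \<gamma>" "\<gamma> \<le> 1" "0 < e"
  shows "\<exists>K a b. finite (K :: int set) \<and> (\<forall>k. 0 \<le> a k \<and> 0 \<le> b k \<and> 0 < a k + b k) \<and>
    (\<forall>t\<in>{m..M}. \<bar>(\<Sum>k\<in>K. t / (a k * t + b k)) - t powr \<gamma>\<bar> \<le> e)"
proof -
  consider "\<gamma> = 0" | "\<gamma> = 1" | "0 < \<gamma>" "\<gamma> < 1"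
    using assms by linarith
  then show ?thesis
  proof cases
    case 1
    then show ?thesis
      using assms by (intro exI[of _ "{0}"] exI[of _ "\<lambda>_. 1"] exI[of _ "\<lambda>_. 0"]) auto
  next
    case 2
    then show ?thesis
      using assms by (intro exI[of _ "{0}"] exI[of _ "\<lambda>_. 0"] exI[of _ "\<lambda>_. 1"]) auto
  next
    case 3
    show ?thesis
    proof (rule powr_approx_open[OF assms(1,2) 3 assms(5)])
      fix K :: "int set" and a b :: "int \<Rightarrow> real"
      assume "finite K" "\<And>k. 0 < a k" "\<And>k. 0 < b k"
        "\<And>t. t \<in> {m..M} \<Longrightarrow> \<bar>t powr \<gamma> - (\<Sum>k\<in>K. t / (a k * t + b k))\<bar> \<le> e"
      then show ?thesis
        by (intro exI[of _ K] exI[of _ a] exI[of _ b])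
          (simp add: abs_minus_commute less_imp_le add_pos_pos)
    qed
  qed
qed


section \<open>Operator convexity\<close>

text \<open>Obtained from the functional calculus, the inverse is symmetric without further argument.\<close>

definition op_inverse :: "'a::complex_hilbert_space operator \<Rightarrow> 'a operator"
  where "op_inverse T = fcalc (\<lambda>t. 1 / t) T"

lemma continuous_fraction:
  "0 \<le> a \<Longrightarrow> 0 \<le> b \<Longrightarrow> 0 < a + b \<Longrightarrow> continuous_on {0<..} (\<lambda>t::real. 1 / (a * t + b))"
  by (intro continuous_intros) (auto simp: add_nonneg_eq_0_iff)

lemma op_inverse:
  assumes "positive_invertible T"
  shows "op_inverse T * T = 1" "T * op_inverse T = 1" "symmetric (op_inverse T)"
proof -
  have cont: "continuous_on {0<..} (\<lambda>t::real. 1 / t)" "continuous_on {0<..} (\<lambda>t::real. t)"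
    by (auto intro!: continuous_intros)
  show "symmetric (op_inverse T)"
    unfolding op_inverse_def using assms cont(1) by (rule symmetric_fcalc)
  have "fcalc (\<lambda>t. 1 / t * t) T = 1"
    using fcalc_cong[OF assms, of "\<lambda>t. 1 / t * t" "\<lambda>t. 1"] fcalc_const[OF assms, of 1]
      continuous_on_mult[OF cont] by simp
  then show "op_inverse T * T = 1"
    using fcalc_mult[OF assms cont] fcalc_id[OF assms] by (simp add: op_inverse_def)
  have "fcalc (\<lambda>t. t * (1 / t)) T = 1"
    using fcalc_cong[OF assms, of "\<lambda>t. t * (1 / t)" "\<lambda>t. 1"] fcalc_const[OF assms, of 1]
      continuous_on_mult[OF cont(2,1)] by simp
  then show "T * op_inverse T = 1"
    using fcalc_mult[OF assms cont(2,1)] fcalc_id[OF assms] by (simp add: op_inverse_def)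
qed

lemma op_inverse_unique:
  assumes "positive_invertible T" "S * T = 1"
  shows "op_inverse T = S"
  by (metis assms mult.assoc mult_1_left mult_1_right op_inverse(2))

lemma fcalc_fraction:
  assumes T: "positive_invertible T" and ab: "0 \<le> a" "0 \<le> b" "0 < a + b"
  shows "fcalc (\<lambda>t. 1 / (a * t + b)) T = op_inverse (a *\<^sub>R T + b *\<^sub>R 1)"
proof -
  note cont = continuous_fraction[OF ab]
  have lin: "continuous_on {0<..} (\<lambda>t. a * t + b)"
    by (intro continuous_intros)
  have "a * t + b \<noteq> 0" if "0 < t" for t
    using ab that by (auto simp: add_nonneg_eq_0_iff)
  then have "fcalc (\<lambda>t. 1 / (a * t + b) * (a * t + b)) T = fcalc (\<lambda>t. 1) T"
    by (intro fcalc_cong T continuous_on_mult cont lin) auto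
  then have "fcalc (\<lambda>t. 1 / (a * t + b)) T * (a *\<^sub>R T + b *\<^sub>R 1) = 1"
    using fcalc_mult[OF T cont lin] fcalc_linear[OF T] fcalc_const[OF T, of 1] by simp
  then show ?thesis
    using T ab
    by (intro op_inverse_unique[symmetric] positive_invertible_combination
        positive_invertible_one) auto
qed

text \<open>
  The joint convexity of \<open>(X, W) \<mapsto> X W\<^sup>-\<^sup>1 X\<close>: completing the square,
  \<open>\<langle>x, X W\<^sup>-\<^sup>1 X x\<rangle>\<close> is the maximum of \<open>2 \<langle>k, X x\<rangle> - \<langle>k, W k\<rangle>\<close> over \<open>k\<close>, attained at
  \<open>k = W\<^sup>-\<^sup>1 X x\<close>, and the latter expressions are affine in
  \<open>(X, W)\<close> and decrease with \<open>W\<close>.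
\<close>

lemma quadratic_over_linear_ge:
  assumes "positive_invertible W" "symmetric X"
  shows "2 * (k \<bullet> (X \<cdot> x)) - k \<bullet> (W \<cdot> k) \<le> x \<bullet> ((X * op_inverse W * X) \<cdot> x)"
proof -
  define v where "v = op_inverse W \<cdot> X \<cdot> x"
  have "W \<cdot> v = (W * op_inverse W) \<cdot> X \<cdot> x"
    by (simp add: v_def)
  then have Wv: "W \<cdot> v = X \<cdot> x"
    by (simp add: op_inverse(2)[OF assms(1)])
  have "0 \<le> (v - k) \<bullet> (W \<cdot> (v - k))"
    using operator_leD[OF positive_invertible_imp_nonneg[OF assms(1)], of "v - k"] by simp
  also have "\<dots> = v \<bullet> (X \<cdot> x) - 2 * (k \<bullet> (X \<cdot> x)) + k \<bullet> (W \<cdot> k)"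
    using symmetricD[OF positive_invertible_imp_symmetric[OF assms(1)], of v k]
    by (simp add: Wv inner_simps inner_commute)
  also have "v \<bullet> (X \<cdot> x) = x \<bullet> ((X * op_inverse W * X) \<cdot> x)"
    using symmetricD[OF assms(2), of x v] by (simp add: v_def inner_commute)
  finally show ?thesis by simp
qed

text \<open>
  The same vector \<open>k\<close>, optimal for the convex combination, is inserted at both end points. Requiring
  only that \<open>W\<close> dominates the combination of \<open>W\<^sub>1\<close> and \<open>W\<^sub>2\<close> lets a concave function be
  substituted for \<open>W\<close>.
\<close>

lemma quadratic_over_linear_convex:
  assumes c: "0 \<le> c" "c \<le> (1::real)"
    and W: "positive_invertible W" "positive_invertible W\<^sub>1" "positive_invertible W\<^sub>2"
    and X: "symmetric X\<^sub>1" "symmetric X\<^sub>2" "X = c *\<^sub>R X\<^sub>1 + (1 - c) *\<^sub>R X\<^sub>2"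
    and le: "c *\<^sub>R W\<^sub>1 + (1 - c) *\<^sub>R W\<^sub>2 \<le> W"
  shows "X * op_inverse W * X
    \<le> c *\<^sub>R (X\<^sub>1 * op_inverse W\<^sub>1 * X\<^sub>1) + (1 - c) *\<^sub>R (X\<^sub>2 * op_inverse W\<^sub>2 * X\<^sub>2)"
proof (rule operator_leI)
  have symX: "symmetric X"
    using X by simp
  show "symmetric (c *\<^sub>R (X\<^sub>1 * op_inverse W\<^sub>1 * X\<^sub>1) + (1 - c) *\<^sub>R (X\<^sub>2 * op_inverse W\<^sub>2 * X\<^sub>2)
      - X * op_inverse W * X)"
    using W X(1,2) symX by (intro symmetric_simps symmetric_sandwich op_inverse(3))
  fix x
  define k where "k = op_inverse W \<cdot> X \<cdot> x"
  have "W \<cdot> k = (W * op_inverse W) \<cdot> X \<cdot> x"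
    by (simp add: k_def)
  then have Wk: "W \<cdot> k = X \<cdot> x"
    by (simp add: op_inverse(2)[OF W(1)])
  have "x \<bullet> ((X * op_inverse W * X) \<cdot> x) = 2 * (k \<bullet> (X \<cdot> x)) - k \<bullet> (W \<cdot> k)"
    using symmetricD[OF symX, of x k] by (simp add: Wk inner_commute flip: k_def)
  also have "\<dots> \<le> 2 * (k \<bullet> (X \<cdot> x)) - k \<bullet> ((c *\<^sub>R W\<^sub>1 + (1 - c) *\<^sub>R W\<^sub>2) \<cdot> k)"
    using operator_leD[OF le, of k] by simp
  also have "\<dots> = c * (2 * (k \<bullet> (X\<^sub>1 \<cdot> x)) - k \<bullet> (W\<^sub>1 \<cdot> k))
      + (1 - c) * (2 * (k \<bullet> (X\<^sub>2 \<cdot> x)) - k \<bullet> (W\<^sub>2 \<cdot> k))"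
    by (simp add: X(3) inner_simps algebra_simps)
  also have "\<dots> \<le> c * (x \<bullet> ((X\<^sub>1 * op_inverse W\<^sub>1 * X\<^sub>1) \<cdot> x))
      + (1 - c) * (x \<bullet> ((X\<^sub>2 * op_inverse W\<^sub>2 * X\<^sub>2) \<cdot> x))"
    using c W X by (intro add_mono mult_left_mono quadratic_over_linear_ge) auto
  finally show "x \<bullet> ((X * op_inverse W * X) \<cdot> x)
    \<le> x \<bullet> ((c *\<^sub>R (X\<^sub>1 * op_inverse W\<^sub>1 * X\<^sub>1)
        + (1 - c) *\<^sub>R (X\<^sub>2 * op_inverse W\<^sub>2 * X\<^sub>2)) \<cdot> x)"
    by (simp add: inner_simps)
qed

lemma scaleR_combination_diff:
  fixes P Q U V :: "'a::real_vector"
  shows "r *\<^sub>R (c *\<^sub>R P + d *\<^sub>R Q - (c *\<^sub>R U + d *\<^sub>R V))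
    = c *\<^sub>R (r *\<^sub>R (P - U)) + d *\<^sub>R (r *\<^sub>R (Q - V))"
  by (simp add: algebra_simps)

lemma continuous_fraction_mult:
  "0 \<le> a \<Longrightarrow> 0 \<le> b \<Longrightarrow> 0 < a + b \<Longrightarrow> continuous_on {0<..} (\<lambda>t::real. t / (a * t + b))"
  using continuous_on_mult[OF continuous_on_id continuous_fraction[of a b]] by simp

text \<open>
  For \<open>a > 0\<close> the function is \<open>1/a - (b/a) / (a t + b)\<close>, so concavity is the convexity of the
  inverse, the case \<open>X = 1\<close> of \<open>quadratic_over_linear_convex\<close>; for \<open>a = 0\<close> it is linear.
\<close>

lemma fraction_concave:
  assumes c: "0 \<le> c" "c \<le> (1::real)" and ab: "0 \<le> a" "0 \<le> b" "0 < a + b"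
    and A: "positive_invertible A" "positive_invertible A\<^sub>1" "positive_invertible A\<^sub>2"
      "A = c *\<^sub>R A\<^sub>1 + (1 - c) *\<^sub>R A\<^sub>2"
  defines "\<phi> \<equiv> fcalc (\<lambda>t. t / (a * t + b)) :: 'a::complex_hilbert_space operator \<Rightarrow> 'a operator"
  shows "c *\<^sub>R \<phi> A\<^sub>1 + (1 - c) *\<^sub>R \<phi> A\<^sub>2 \<le> \<phi> A"
proof (cases "a = 0")
  case True
  then have "\<phi> T = (1 / b) *\<^sub>R T" if "positive_invertible T" for T
    using fcalc_linear[OF that, of "1 / b" 0] by (simp add: \<phi>_def)
  then show ?thesis
    using A by (simp add: scaleR_add_right)
next
  case False
  then have "0 < a" using ab by simp
  define W where "W T = a *\<^sub>R T + b *\<^sub>R 1" for T :: "'a operator"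
  have W: "positive_invertible (W T)" if "positive_invertible T" for T
    unfolding W_def using ab that by (intro positive_invertible_combination positive_invertible_one)
  have \<phi>: "\<phi> T = (1 / a) *\<^sub>R (1 - b *\<^sub>R op_inverse (W T))" if T: "positive_invertible T" for T
  proof -
    have "has_calculus (\<lambda>t. t / (a * t + b)) T ((1 / a) *\<^sub>R (1 - b *\<^sub>R op_inverse (W T)))"
    proof (rule has_calculus_cong)
      have sym: "symmetric T"
        using T by (rule positive_invertible_imp_symmetric)
      have "peval 1 T = 1"
        by (simp add: one_pCons)
      then have one: "has_calculus (poly 1) T 1"
        using has_calculus_poly[of 1 T] by simp
      show "has_calculus (\<lambda>t. (1 / a) * (poly 1 t - b * (1 / (a * t + b)))) T
          ((1 / a) *\<^sub>R (1 - b *\<^sub>R op_inverse (W T)))"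
        unfolding W_def fcalc_fraction[OF T ab, symmetric]
        by (intro has_calculus_scaleR[OF sym] has_calculus_diff[OF sym] one
            has_calculus_fcalc[OF T] continuous_fraction[OF ab])
      fix t assume "t \<in> real_spectrum T"
      then have "0 < t"
        using real_spectrum_bounds[OF T] by (metis atLeastAtMost_iff less_le_trans subsetD)
      then have "0 < a * t + b"
        using \<open>0 < a\<close> ab by (simp add: add_pos_nonneg)
      then show "(1 / a) * (poly 1 t - b * (1 / (a * t + b))) = t / (a * t + b)"
        using \<open>0 < a\<close> by (simp add: field_simps)
    qed
    then show ?thesis
      unfolding \<phi>_def using T by (intro fcalc_eqI)
  qed
  have "1 * op_inverse (W A) * 1
      \<le> c *\<^sub>R (1 * op_inverse (W A\<^sub>1) * 1) + (1 - c) *\<^sub>R (1 * op_inverse (W A\<^sub>2) * 1)"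
  proof (rule quadratic_over_linear_convex[OF c W W W])
    show "c *\<^sub>R W A\<^sub>1 + (1 - c) *\<^sub>R W A\<^sub>2 \<le> W A"
      by (simp add: W_def A(4) algebra_simps)
  qed (use A in \<open>simp_all flip: scaleR_add_left\<close>)
  then have "b *\<^sub>R op_inverse (W A)
      \<le> b *\<^sub>R (c *\<^sub>R op_inverse (W A\<^sub>1) + (1 - c) *\<^sub>R op_inverse (W A\<^sub>2))"
    using ab(2) by (intro scaleR_left_mono) simp_all
  then have "(1 / a) *\<^sub>R (1 - b *\<^sub>R (c *\<^sub>R op_inverse (W A\<^sub>1) + (1 - c) *\<^sub>R op_inverse (W A\<^sub>2)))
      \<le> (1 / a) *\<^sub>R (1 - b *\<^sub>R op_inverse (W A))"
    using \<open>0 < a\<close> by (intro scaleR_left_mono[OF diff_left_mono]) simp_all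
  also have "(1 / a) *\<^sub>R (1 - b *\<^sub>R (c *\<^sub>R op_inverse (W A\<^sub>1) + (1 - c) *\<^sub>R op_inverse (W A\<^sub>2)))
      = (1 / a) *\<^sub>R (c *\<^sub>R 1 + (1 - c) *\<^sub>R 1
        - (c *\<^sub>R b *\<^sub>R op_inverse (W A\<^sub>1) + (1 - c) *\<^sub>R b *\<^sub>R op_inverse (W A\<^sub>2)))"
    by (simp add: scaleR_add_right mult.commute flip: scaleR_add_left)
  also have "\<dots> = c *\<^sub>R \<phi> A\<^sub>1 + (1 - c) *\<^sub>R \<phi> A\<^sub>2"
    by (simp only: scaleR_combination_diff \<phi> A(2,3))
  finally show ?thesis
    by (simp add: \<phi> A(1))
qed

definition op_power :: "'a::complex_hilbert_space operator \<Rightarrow> real \<Rightarrow> 'a operator"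
  where "op_power T r = fcalc (\<lambda>t. t powr r) T"

lemma continuous_powr: "continuous_on {0<..} (\<lambda>t::real. t powr r)"
  by (intro continuous_intros) auto

lemma symmetric_op_power: "positive_invertible T \<Longrightarrow> symmetric (op_power T r)"
  unfolding op_power_def by (intro symmetric_fcalc continuous_powr)

lemma positive_invertible_op_power: "positive_invertible T \<Longrightarrow> positive_invertible (op_power T r)"
  unfolding op_power_def by (intro positive_invertible_fcalc continuous_powr) auto

lemma op_power_add:
  assumes "positive_invertible T"
  shows "op_power T r * op_power T s = op_power T (r + s)"
  unfolding op_power_def fcalc_mult[OF assms continuous_powr continuous_powr, symmetric]
  by (simp add: powr_add)

lemma op_power_0: "positive_invertible T \<Longrightarrow> op_power T 0 = 1"
  using fcalc_cong[of T "\<lambda>t. t powr 0" "\<lambda>t. 1"] continuous_powr[of 0] fcalc_const[of T 1]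
  by (simp add: op_power_def)

lemma blinfun_of_op_power:
  "positive_invertible T \<Longrightarrow> blinfun_of T powr\<^sub>o\<^sub>p r = blinfun_of (op_power T r)"
  unfolding op_powr_def op_power_def
  by (intro fun_calc_blinfun_of positive_invertible_imp_symmetric has_calculus_fcalc continuous_powr)

lemma powr_approx_sequence:
  fixes m M \<gamma> :: real
  assumes "0 < m" "m \<le> M" "0 \<le> \<gamma>" "\<gamma> \<le> 1"
  shows "\<exists>K a b. \<forall>n. finite (K n :: int set) \<and>
    (\<forall>k. 0 \<le> a n k \<and> 0 \<le> b n k \<and> 0 < a n k + b n k) \<and>
    (\<forall>t\<in>{m..M}. \<bar>(\<Sum>k\<in>K n. t / (a n k * t + b n k)) - t powr \<gamma>\<bar> \<le> 1 / real (Suc n))"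
proof -
  have "\<forall>n. \<exists>K a b. finite (K :: int set) \<and> (\<forall>k. 0 \<le> a k \<and> 0 \<le> b k \<and> 0 < a k + b k) \<and>
    (\<forall>t\<in>{m..M}. \<bar>(\<Sum>k\<in>K. t / (a k * t + b k)) - t powr \<gamma>\<bar> \<le> 1 / real (Suc n))"
    by (intro allI powr_approx assms) simp
  then show ?thesis
    by (simp only: choice_iff)
qed

lemma fcalc_tendsto:
  assumes T: "positive_invertible T" "m *\<^sub>R 1 \<le> T" "T \<le> M *\<^sub>R 1"
    and cont: "\<And>n. continuous_on {0<..} (f n)" "continuous_on {0<..} g" and "0 \<le> C"
    and close: "\<And>n t. t \<in> {m..M} \<Longrightarrow> \<bar>f n t - g t\<bar> \<le> C * (1 / real (Suc n))"
  shows "(\<lambda>n. fcalc (f n) T) \<longlonglongrightarrow> fcalc g T"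
proof (rule Lim_null_comparison[THEN LIM_zero_cancel])
  show "\<forall>\<^sub>F n in sequentially. norm (fcalc (f n) T - fcalc g T) \<le> C * (1 / real (Suc n))"
    using \<open>0 \<le> C\<close> by (intro always_eventually allI fcalc_dist_le[where m = m and M = M] T cont close) auto
  show "(\<lambda>n. C * (1 / real (Suc n))) \<longlonglongrightarrow> 0"
    using tendsto_mult_right[OF LIMSEQ_inverse_real_of_nat, of C] by (simp add: inverse_eq_divide)
qed

text \<open>
  The Loewner--Heinz concavity: \<open>t\<^sup>\<beta>\<close> is a uniform limit of sums of the operator concave fractions
  \<open>t / (a t + b)\<close>, and the order is closed.
\<close>

lemma op_power_concave:
  fixes A\<^sub>1 A\<^sub>2 :: "'a::complex_hilbert_space operator"
  assumes c: "0 \<le> c" "c \<le> (1::real)" and \<beta>: "0 \<le> \<beta>" "\<beta> \<le> 1"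
    and A: "positive_invertible A" "positive_invertible A\<^sub>1" "positive_invertible A\<^sub>2"
      "A = c *\<^sub>R A\<^sub>1 + (1 - c) *\<^sub>R A\<^sub>2"
  shows "c *\<^sub>R op_power A\<^sub>1 \<beta> + (1 - c) *\<^sub>R op_power A\<^sub>2 \<beta> \<le> op_power A \<beta>"
proof -
  obtain m M where m: "0 < m" "m \<le> M"
    and bounds: "\<forall>T\<in>{A, A\<^sub>1, A\<^sub>2}. m *\<^sub>R 1 \<le> T \<and> T \<le> M *\<^sub>R 1"
    using A by (elim positive_invertible_bounds[of "{A, A\<^sub>1, A\<^sub>2}" "\<lambda>T. T", rotated 2]) auto
  obtain K a b where approx: "\<forall>n. finite (K n :: int set) \<and>
      (\<forall>k. 0 \<le> a n k \<and> 0 \<le> b n k \<and> 0 < a n k + b n k) \<and>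
      (\<forall>t\<in>{m..M}. \<bar>(\<Sum>k\<in>K n. t / (a n k * t + b n k)) - t powr \<beta>\<bar> \<le> 1 / real (Suc n))"
    using powr_approx_sequence[OF m \<beta>] by (elim exE)
  then have K: "finite (K n)"
    and ab: "0 \<le> a n k" "0 \<le> b n k" "0 < a n k + b n k" for n k
    by blast+
  have close: "\<bar>(\<Sum>k\<in>K n. t / (a n k * t + b n k)) - t powr \<beta>\<bar> \<le> 1 / real (Suc n)"
    if "t \<in> {m..M}" for n t
    using approx that by blast
  define f where "f n t = (\<Sum>k\<in>K n. t / (a n k * t + b n k))" for n t
  have cont: "continuous_on {0<..} (f n)" for n
    unfolding f_def by (intro continuous_on_sum continuous_fraction_mult ab)
  have lim: "(\<lambda>n. fcalc (f n) T) \<longlonglongrightarrow> op_power T \<beta>" if "T \<in> {A, A\<^sub>1, A\<^sub>2}" for T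
    unfolding op_power_def using that A bounds close
    by (intro fcalc_tendsto[of T m M _ _ 1] cont continuous_powr) (auto simp: f_def)
  have sum: "fcalc (f n) T = (\<Sum>k\<in>K n. fcalc (\<lambda>t. t / (a n k * t + b n k)) T)"
    if "positive_invertible T" for n and T :: "'a operator"
    unfolding f_def by (intro fcalc_sum that K continuous_fraction_mult ab)
  show ?thesis
  proof (rule operator_le_limit)
    show "c *\<^sub>R fcalc (f n) A\<^sub>1 + (1 - c) *\<^sub>R fcalc (f n) A\<^sub>2 \<le> fcalc (f n) A" for n
      unfolding sum[OF A(1)] sum[OF A(2)] sum[OF A(3)] scaleR_sum_right sum.distrib[symmetric]
      by (intro sum_mono fraction_concave c ab A)
    show "(\<lambda>n. fcalc (f n) A) \<longlonglongrightarrow> op_power A \<beta>"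
      by (intro lim) simp
    show "(\<lambda>n. c *\<^sub>R fcalc (f n) A\<^sub>1 + (1 - c) *\<^sub>R fcalc (f n) A\<^sub>2)
        \<longlonglongrightarrow> c *\<^sub>R op_power A\<^sub>1 \<beta> + (1 - c) *\<^sub>R op_power A\<^sub>2 \<beta>"
      by (intro tendsto_intros lim) simp_all
  qed
qed


section \<open>The operator perspective\<close>

text \<open>
  This is the operator perspective of \<open>t\<^sup>\<alpha>\<close> at the pair \<open>(B, A\<^sup>\<beta>)\<close>. The entropy is
  \<open>1/\<alpha>\<close> times its difference with \<open>A\<^sup>\<beta>\<close>.
\<close>

definition tsallis_power ::
    "real \<Rightarrow> real \<Rightarrow> 'a::complex_hilbert_space operator \<Rightarrow> 'a operator \<Rightarrow> 'a operator"
  where "tsallis_power \<alpha> \<beta> A B = op_power A (\<beta>/2) *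
    op_power (op_power A (-\<beta>/2) * B * op_power A (-\<beta>/2)) \<alpha> * op_power A (\<beta>/2)"

lemma positive_invertible_sandwich:
  assumes "positive_invertible A" "positive_invertible B"
  shows "positive_invertible (op_power A r * B * op_power A r)"
proof -
  obtain m where m: "0 < m" "m *\<^sub>R 1 \<le> B"
    using assms(2) by (auto simp: positive_invertible_def)
  have "op_power A r * (m *\<^sub>R 1) * op_power A r \<le> op_power A r * B * op_power A r"
    by (intro sandwich_mono symmetric_op_power assms m)
  moreover have "positive_invertible (m *\<^sub>R op_power A (r + r))"
    by (intro positive_invertible_scaleR positive_invertible_op_power assms m)
  ultimately show ?thesis
    using positive_invertible_mono by (simp add: op_power_add assms(1))
qed

lemma symmetric_tsallis_power:
  "positive_invertible A \<Longrightarrow> positive_invertible B \<Longrightarrow> symmetric (tsallis_power \<alpha> \<beta> A B)"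
  unfolding tsallis_power_def
  by (intro symmetric_sandwich symmetric_op_power positive_invertible_sandwich)

text \<open>
  With \<open>C = A\<^bsup>\<beta>/2\<^esup>\<close>, \<open>D = C\<^sup>-\<^sup>1\<close>, \<open>Z = D B D\<close> one has
  \<open>C (a Z + b) C = a B + b A\<^sup>\<beta>\<close>; inverting this and using \<open>C Z = B D\<close> removes all the roots.
\<close>

lemma sandwich_fraction:
  fixes A B :: "'a::complex_hilbert_space operator"
  assumes A: "positive_invertible A" and B: "positive_invertible B"
    and ab: "0 \<le> a" "0 \<le> b" "0 < a + b"
  shows "op_power A (\<beta>/2) *
      fcalc (\<lambda>t. t * (t / (a * t + b))) (op_power A (-\<beta>/2) * B * op_power A (-\<beta>/2)) *
      op_power A (\<beta>/2)
    = B * op_inverse (a *\<^sub>R B + b *\<^sub>R op_power A \<beta>) * B"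
proof -
  define C where "C = op_power A (\<beta>/2)"
  define D where "D = op_power A (-\<beta>/2)"
  define Z where "Z = D * B * D"
  have CD: "C * D = 1" "D * C = 1" and CC: "C * C = op_power A \<beta>"
    using A by (simp_all add: C_def D_def op_power_add op_power_0)
  have cancel: "C * (D * T) = T" "D * (C * T) = T" for T
    by (simp_all add: CD flip: mult.assoc)
  have Z: "positive_invertible Z"
    unfolding Z_def D_def by (intro positive_invertible_sandwich A B)
  define V where "V = op_inverse (a *\<^sub>R Z + b *\<^sub>R 1)"
  have W: "positive_invertible (a *\<^sub>R Z + b *\<^sub>R 1)"
    using ab Z by (intro positive_invertible_combination positive_invertible_one)
  have "(D * V * D) * (a *\<^sub>R B + b *\<^sub>R op_power A \<beta>) = D * (V * (a *\<^sub>R Z + b *\<^sub>R 1)) * C"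
    by (simp add: Z_def CC[symmetric] algebra_simps cancel CD)
  also have "\<dots> = 1"
    by (simp add: V_def op_inverse(1)[OF W] CD)
  finally have inv: "op_inverse (a *\<^sub>R B + b *\<^sub>R op_power A \<beta>) = D * V * D"
    using ab by (intro op_inverse_unique positive_invertible_combination
        positive_invertible_op_power A B)
  have id: "continuous_on {0<..} (\<lambda>t::real. t)"
    by (intro continuous_intros)
  have "fcalc (\<lambda>t. t * (1 / (a * t + b) * t)) Z = Z * (V * Z)"
    unfolding V_def fcalc_fraction[OF Z ab, symmetric]
    by (simp only: fcalc_mult[OF Z] fcalc_id[OF Z] id continuous_fraction[OF ab]
        continuous_on_mult)
  then have "C * fcalc (\<lambda>t. t * (t / (a * t + b))) Z * C = C * (Z * (V * Z)) * C"
    by simp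
  also have "\<dots> = B * (D * V * D) * B"
    by (simp add: Z_def mult.assoc cancel CD)
  finally show ?thesis
    by (simp add: inv C_def D_def Z_def)
qed

text \<open>
  With \<open>\<gamma> = \<alpha> - 1\<close>, approximate \<open>t\<^sup>\<alpha> = t \<sqdot> t\<^sup>\<gamma>\<close> by sums of \<open>t\<^sup>2 / (a t + b)\<close>. Each such term turns
  into \<open>B (a B + b A\<^sup>\<beta>)\<^sup>-\<^sup>1 B\<close>, where \<open>X W\<^sup>-\<^sup>1 X\<close> is jointly convex
  and decreasing in \<open>W\<close>, and \<open>a B + b A\<^sup>\<beta>\<close> is concave.
\<close>

lemma tsallis_power_convex:
  fixes A\<^sub>1 A\<^sub>2 B\<^sub>1 B\<^sub>2 :: "'a::complex_hilbert_space operator"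
  assumes c: "0 \<le> c" "c \<le> (1::real)" and \<alpha>: "1 \<le> \<alpha>" "\<alpha> \<le> 2" and \<beta>: "0 \<le> \<beta>" "\<beta> \<le> 1"
    and A: "positive_invertible A" "positive_invertible A\<^sub>1" "positive_invertible A\<^sub>2"
      "A = c *\<^sub>R A\<^sub>1 + (1 - c) *\<^sub>R A\<^sub>2"
    and B: "positive_invertible B" "positive_invertible B\<^sub>1" "positive_invertible B\<^sub>2"
      "B = c *\<^sub>R B\<^sub>1 + (1 - c) *\<^sub>R B\<^sub>2"
  shows "tsallis_power \<alpha> \<beta> A B
    \<le> c *\<^sub>R tsallis_power \<alpha> \<beta> A\<^sub>1 B\<^sub>1 + (1 - c) *\<^sub>R tsallis_power \<alpha> \<beta> A\<^sub>2 B\<^sub>2"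
proof -
  define Z where "Z S T = op_power S (-\<beta>/2) * T * op_power S (-\<beta>/2)" for S T :: "'a operator"
  have Z_pos: "positive_invertible (Z S T)" if "positive_invertible S" "positive_invertible T" for S T
    unfolding Z_def by (intro positive_invertible_sandwich that)
  let ?pairs = "{(A, B), (A\<^sub>1, B\<^sub>1), (A\<^sub>2, B\<^sub>2)}"
  have pairs: "positive_invertible S \<and> positive_invertible T" if "(S, T) \<in> ?pairs" for S T
    using that A B by auto
  obtain m M where m: "0 < m" "m \<le> M" and bounds':
    "\<forall>T\<in>{Z A B, Z A\<^sub>1 B\<^sub>1, Z A\<^sub>2 B\<^sub>2}. m *\<^sub>R 1 \<le> T \<and> T \<le> M *\<^sub>R 1"
  proof (rule positive_invertible_bounds)
    show "finite {Z A B, Z A\<^sub>1 B\<^sub>1, Z A\<^sub>2 B\<^sub>2}"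
      by simp
    show "positive_invertible T" if "T \<in> {Z A B, Z A\<^sub>1 B\<^sub>1, Z A\<^sub>2 B\<^sub>2}" for T
      using that Z_pos A B by auto
  qed
  have bounds: "m *\<^sub>R 1 \<le> Z S T" "Z S T \<le> M *\<^sub>R 1" if "(S, T) \<in> ?pairs" for S T
    using that bounds' by auto
  have \<gamma>: "0 \<le> \<alpha> - 1" "\<alpha> - 1 \<le> 1"
    using \<alpha> by simp_all
  obtain K a b where approx: "\<forall>n. finite (K n :: int set) \<and>
      (\<forall>k. 0 \<le> a n k \<and> 0 \<le> b n k \<and> 0 < a n k + b n k) \<and>
      (\<forall>t\<in>{m..M}. \<bar>(\<Sum>k\<in>K n. t / (a n k * t + b n k)) - t powr (\<alpha> - 1)\<bar> \<le> 1 / real (Suc n))"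
    using powr_approx_sequence[OF m \<gamma>] by (elim exE)
  then have K: "finite (K n)"
    and ab: "0 \<le> a n k" "0 \<le> b n k" "0 < a n k + b n k" for n k
    by blast+
  have close: "\<bar>(\<Sum>k\<in>K n. t / (a n k * t + b n k)) - t powr (\<alpha> - 1)\<bar> \<le> 1 / real (Suc n)"
    if "t \<in> {m..M}" for n t
    using approx that by blast
  define \<phi> where "\<phi> n k t = t * (t / (a n k * t + b n k))" for n k t
  have cont_\<phi>: "continuous_on {0<..} (\<phi> n k)" for n k
    unfolding \<phi>_def by (intro continuous_on_mult continuous_on_id continuous_fraction_mult ab)
  define f where "f n t = (\<Sum>k\<in>K n. \<phi> n k t)" for n t
  have cont_f: "continuous_on {0<..} (f n)" for n
    unfolding f_def by (intro continuous_on_sum cont_\<phi>)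
  define F where "F n S T = op_power S (\<beta>/2) * fcalc (f n) (Z S T) * op_power S (\<beta>/2)"
    for n and S T :: "'a operator"
  have close_f: "\<bar>f n t - t powr \<alpha>\<bar> \<le> M * (1 / real (Suc n))" if "t \<in> {m..M}" for n t
  proof -
    have "0 < t" "t \<le> M"
      using that m by auto
    then have "f n t - t powr \<alpha> = t * ((\<Sum>k\<in>K n. t / (a n k * t + b n k)) - t powr (\<alpha> - 1))"
      by (simp add: f_def \<phi>_def right_diff_distrib sum_distrib_left powr_diff)
    then have "\<bar>f n t - t powr \<alpha>\<bar>
        = t * \<bar>(\<Sum>k\<in>K n. t / (a n k * t + b n k)) - t powr (\<alpha> - 1)\<bar>"
      using \<open>0 < t\<close> by (simp add: abs_mult)
    also have "\<dots> \<le> M * (1 / real (Suc n))"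
      using close[OF that] \<open>0 < t\<close> \<open>t \<le> M\<close> by (intro mult_mono) auto
    finally show ?thesis .
  qed
  have lim: "(\<lambda>n. F n S T) \<longlonglongrightarrow> tsallis_power \<alpha> \<beta> S T" if "(S, T) \<in> ?pairs" for S T
  proof -
    have "(\<lambda>n. fcalc (f n) (Z S T)) \<longlonglongrightarrow> op_power (Z S T) \<alpha>"
      unfolding op_power_def
      using pairs[OF that] bounds[OF that] m close_f
      by (intro fcalc_tendsto[of _ m M _ _ M] Z_pos cont_f continuous_powr) auto
    then show ?thesis
      unfolding F_def tsallis_power_def Z_def by (intro tendsto_mult tendsto_const)
  qed
  define G where "G n k S T = T * op_inverse (a n k *\<^sub>R T + b n k *\<^sub>R op_power S \<beta>) * T"
    for n k and S T :: "'a operator"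
  have F_sum: "F n S T = (\<Sum>k\<in>K n. G n k S T)"
    if "positive_invertible S" "positive_invertible T" for n S T
  proof -
    have "fcalc (f n) (Z S T) = (\<Sum>k\<in>K n. fcalc (\<phi> n k) (Z S T))"
      unfolding f_def by (intro fcalc_sum Z_pos that K cont_\<phi>)
    then have "F n S T = (\<Sum>k\<in>K n. op_power S (\<beta>/2) * fcalc (\<phi> n k) (Z S T) * op_power S (\<beta>/2))"
      by (simp add: F_def sum_distrib_left sum_distrib_right)
    then show ?thesis
      unfolding \<phi>_def Z_def G_def sandwich_fraction[OF that ab] .
  qed
  have G_convex: "G n k A B \<le> c *\<^sub>R G n k A\<^sub>1 B\<^sub>1 + (1 - c) *\<^sub>R G n k A\<^sub>2 B\<^sub>2" for n k
    unfolding G_def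
  proof (rule quadratic_over_linear_convex[OF c])
    have "b n k *\<^sub>R (c *\<^sub>R op_power A\<^sub>1 \<beta> + (1 - c) *\<^sub>R op_power A\<^sub>2 \<beta>) \<le> b n k *\<^sub>R op_power A \<beta>"
      by (intro scaleR_left_mono op_power_concave c \<beta> A ab)
    then have "a n k *\<^sub>R B + b n k *\<^sub>R (c *\<^sub>R op_power A\<^sub>1 \<beta> + (1 - c) *\<^sub>R op_power A\<^sub>2 \<beta>)
        \<le> a n k *\<^sub>R B + b n k *\<^sub>R op_power A \<beta>"
      by (rule add_left_mono)
    then show "c *\<^sub>R (a n k *\<^sub>R B\<^sub>1 + b n k *\<^sub>R op_power A\<^sub>1 \<beta>)
        + (1 - c) *\<^sub>R (a n k *\<^sub>R B\<^sub>2 + b n k *\<^sub>R op_power A\<^sub>2 \<beta>)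
        \<le> a n k *\<^sub>R B + b n k *\<^sub>R op_power A \<beta>"
      by (simp add: B(4) scaleR_add_right mult.commute add_ac)
  qed (use A B ab in \<open>auto intro!: positive_invertible_combination positive_invertible_op_power
        positive_invertible_imp_symmetric\<close>)
  show ?thesis
  proof (rule operator_le_limit)
    show "F n A B \<le> c *\<^sub>R F n A\<^sub>1 B\<^sub>1 + (1 - c) *\<^sub>R F n A\<^sub>2 B\<^sub>2" for n
      unfolding F_sum[OF A(1) B(1)] F_sum[OF A(2) B(2)] F_sum[OF A(3) B(3)]
        scaleR_sum_right sum.distrib[symmetric]
      by (intro sum_mono G_convex)
    show "(\<lambda>n. F n A B) \<longlonglongrightarrow> tsallis_power \<alpha> \<beta> A B"
      by (intro lim) simp
    show "(\<lambda>n. c *\<^sub>R F n A\<^sub>1 B\<^sub>1 + (1 - c) *\<^sub>R F n A\<^sub>2 B\<^sub>2) \<longlonglongrightarrow>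
        c *\<^sub>R tsallis_power \<alpha> \<beta> A\<^sub>1 B\<^sub>1 + (1 - c) *\<^sub>R tsallis_power \<alpha> \<beta> A\<^sub>2 B\<^sub>2"
      by (intro tendsto_intros lim) simp_all
  qed
qed


section \<open>Joint convexity of the Tsallis relative operator entropy\<close>

lemma self_adjoint_blinfun_of: "self_adjoint (blinfun_of T) \<longleftrightarrow> symmetric T"
proof
  assume "self_adjoint (blinfun_of T)"
  then show "symmetric T"
    by (simp add: self_adjoint_def symmetric_def inner_eq_Re_cinner apply_op.rep_eq)
next
  assume symm: "symmetric T"
  \<comment> \<open>The imaginary part of the form is recovered from the real one by complex linearity.\<close>
  have Im: "Im (cinner u v) = - (u \<bullet> (\<i> *\<^sub>C v))" for u v :: 'a
    by (simp add: inner_eq_Re_cinner cinner_scaleC_right)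
  have "cinner (T \<cdot> x) y = cinner x (T \<cdot> y)" for x y
  proof (rule complex_eqI)
    show "Re (cinner (T \<cdot> x) y) = Re (cinner x (T \<cdot> y))"
      using symmetricD[OF symm, of x y] by (simp add: inner_eq_Re_cinner)
    show "Im (cinner (T \<cdot> x) y) = Im (cinner x (T \<cdot> y))"
      by (simp add: Im symmetricD[OF symm] apply_op_scaleC)
  qed
  then show "self_adjoint (blinfun_of T)"
    by (simp add: self_adjoint_def bounded_op_blinfun_of apply_op.rep_eq)
qed

lemma positive_op_blinfun_of: "positive_op (blinfun_of T) \<longleftrightarrow> 0 \<le> T"
proof -
  have "positive_op (blinfun_of T) \<longleftrightarrow> symmetric T \<and> (\<forall>x. 0 \<le> x \<bullet> (T \<cdot> x))"
    by (simp add: positive_op_def self_adjoint_blinfun_of inner_eq_Re_cinner apply_op.rep_eq)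
  then show ?thesis
    by (simp add: less_eq_operator_def)
qed

lemma op_le_blinfun_of: "blinfun_of S \<le>\<^sub>o\<^sub>p blinfun_of T \<longleftrightarrow> S \<le> T"
  by (simp add: op_le_def positive_op_blinfun_of flip: blinfun_of_eqs)

text \<open>
  Invertibility bounds \<open>\<parallel>T x\<parallel>\<close> from below, and for positive \<open>T\<close> the form at
  \<open>x - T x / N\<close> with \<open>N \<ge> \<parallel>T\<parallel>\<close> is nonnegative, which gives
  \<open>\<parallel>T x\<parallel>\<^sup>2 \<le> N \<langle>x, T x\<rangle>\<close>.
\<close>

lemma positive_unit_op_imp_positive_invertible:
  assumes "0 \<le> T" "unit_op T" shows "positive_invertible T"
proof -
  have symm: "symmetric T"
    using assms(1) by (rule nonneg_imp_symmetric)
  obtain V where "V * T = 1"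
    using assms(2) by (auto simp: unit_op_def)
  then have V: "V \<cdot> T \<cdot> x = x" for x
    by (metis apply_op_simps(2,7))
  define v where "v = norm V + 1"
  define N where "N = norm T + 1"
  have "0 < v" "0 < N"
    by (simp_all add: v_def N_def add_nonneg_pos)
  have "1 / (v\<^sup>2 * N) * (x \<bullet> x) \<le> x \<bullet> (T \<cdot> x)" for x
  proof -
    have "norm x \<le> norm V * norm (T \<cdot> x)"
      using norm_apply_op[of V "T \<cdot> x"] by (simp add: V)
    also have "\<dots> \<le> v * norm (T \<cdot> x)"
      by (intro mult_right_mono) (simp_all add: v_def)
    finally have "(norm x)\<^sup>2 \<le> (v * norm (T \<cdot> x))\<^sup>2"
      by (intro power_mono) auto
    then have lower: "x \<bullet> x \<le> v\<^sup>2 * ((T \<cdot> x) \<bullet> (T \<cdot> x))"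
      by (simp add: power_mult_distrib power2_norm_eq_inner)
    define y where "y = T \<cdot> x"
    have "y \<bullet> (T \<cdot> y) \<le> norm T * (y \<bullet> y)"
      using operator_leD[OF symmetric_le_norm[OF symm], of y] by simp
    also have "\<dots> \<le> N * (y \<bullet> y)"
      by (intro mult_right_mono) (simp_all add: N_def)
    finally have upper: "y \<bullet> (T \<cdot> y) / N \<le> y \<bullet> y"
      using \<open>0 < N\<close> by (simp add: field_simps)
    have "0 \<le> (x - (1 / N) *\<^sub>R y) \<bullet> (T \<cdot> (x - (1 / N) *\<^sub>R y))"
      using operator_leD[OF assms(1), of "x - (1 / N) *\<^sub>R y"] by simp
    also have "\<dots> = x \<bullet> y - 2 / N * (y \<bullet> y) + 1 / N * (y \<bullet> (T \<cdot> y) / N)"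
      using symmetricD[OF symm, of x y]
      by (simp add: inner_simps inner_commute algebra_simps flip: y_def)
    also have "\<dots> \<le> x \<bullet> y - 2 / N * (y \<bullet> y) + 1 / N * (y \<bullet> y)"
      using upper \<open>0 < N\<close> by (intro add_left_mono mult_left_mono) auto
    finally have "1 / N * (y \<bullet> y) \<le> x \<bullet> y"
      by simp
    moreover have "1 / (v\<^sup>2 * N) * (x \<bullet> x) \<le> 1 / N * (y \<bullet> y)"
      using lower \<open>0 < v\<close> \<open>0 < N\<close> by (simp add: y_def field_simps)
    ultimately show ?thesis
      by (simp add: y_def)
  qed
  then have "(1 / (v\<^sup>2 * N)) *\<^sub>R 1 \<le> T"
    using symm by (intro operator_leI) simp_all
  moreover have "0 < 1 / (v\<^sup>2 * N)"
    using \<open>0 < v\<close> \<open>0 < N\<close> by simp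
  ultimately show ?thesis
    unfolding positive_invertible_def by blast
qed

lemma strictly_positive_imp_blinfun_of:
  assumes "strictly_positive T"
  obtains S where "T = blinfun_of S" "positive_invertible S"
proof -
  have "bounded_op T"
    using assms by (simp add: strictly_positive_def positive_op_def self_adjoint_def)
  then have T: "T = blinfun_of (Operator T)"
    by (simp add: Operator_inverse)
  then have "0 \<le> Operator T" "unit_op (Operator T)"
    using assms unfolding strictly_positive_def
    by (metis positive_op_blinfun_of invertible_op_blinfun_of)+
  then show thesis
    using that T positive_unit_op_imp_positive_invertible by blast
qed

lemma tsallis_entropy_blinfun_of:
  assumes A: "positive_invertible A" and B: "positive_invertible B"
  shows "tsallis_entropy \<alpha> \<beta> (blinfun_of A) (blinfun_of B)
    = blinfun_of ((1 / \<alpha>) *\<^sub>R (tsallis_power \<alpha> \<beta> A B - op_power A \<beta>))"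
proof -
  have "positive_invertible (op_power A (-\<beta>/2) * B * op_power A (-\<beta>/2))"
    by (intro positive_invertible_sandwich A B)
  then have "tsallis_entropy \<alpha> \<beta> (blinfun_of A) (blinfun_of B) = blinfun_of (op_power A (\<beta>/2) *
      ((1 / \<alpha>) *\<^sub>R (op_power (op_power A (-\<beta>/2) * B * op_power A (-\<beta>/2)) \<alpha> - 1)) *
      op_power A (\<beta>/2))"
    unfolding tsallis_entropy_def tsallis_ln_def
    by (simp only: A blinfun_of_op_power flip: blinfun_of_eqs)
  also have "op_power A (\<beta>/2) *
      ((1 / \<alpha>) *\<^sub>R (op_power (op_power A (-\<beta>/2) * B * op_power A (-\<beta>/2)) \<alpha> - 1)) *
      op_power A (\<beta>/2)
    = (1 / \<alpha>) *\<^sub>R (tsallis_power \<alpha> \<beta> A B - op_power A (\<beta>/2) * op_power A (\<beta>/2))"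
    by (simp add: tsallis_power_def algebra_simps)
  finally show ?thesis
    by (simp add: op_power_add A)
qed

theorem theorem2p2:
  fixes \<alpha> \<beta> :: real
  assumes "infinite_dimensional TYPE('a::complex_hilbert_space)"
    and "separable_type TYPE('a)"
    and "\<alpha> \<in> {1..2}" and "\<beta> \<in> {0..1}"
  shows "jointly_convex
    (tsallis_entropy \<alpha> \<beta> ::
      ('a \<Rightarrow>\<^sub>L 'a) \<Rightarrow> ('a \<Rightarrow>\<^sub>L 'a) \<Rightarrow> 'a \<Rightarrow>\<^sub>L 'a)"
  unfolding jointly_convex_def
proof (intro conjI allI ballI impI)
  fix A B :: "'a \<Rightarrow>\<^sub>L 'a"
  assume "strictly_positive A" "strictly_positive B"
  then show "self_adjoint (tsallis_entropy \<alpha> \<beta> A B)"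
    by (elim strictly_positive_imp_blinfun_of)
      (simp add: tsallis_entropy_blinfun_of self_adjoint_blinfun_of symmetric_tsallis_power
        symmetric_op_power)
next
  fix A1 A2 B1 B2 :: "'a \<Rightarrow>\<^sub>L 'a" and c :: real
  assume c: "c \<in> {0..1}"
    and "strictly_positive A1" "strictly_positive A2" "strictly_positive B1" "strictly_positive B2"
  then obtain A\<^sub>1 A\<^sub>2 B\<^sub>1 B\<^sub>2 where eqs: "A1 = blinfun_of A\<^sub>1" "A2 = blinfun_of A\<^sub>2"
      "B1 = blinfun_of B\<^sub>1" "B2 = blinfun_of B\<^sub>2"
    and pos: "positive_invertible A\<^sub>1" "positive_invertible A\<^sub>2"
      "positive_invertible B\<^sub>1" "positive_invertible B\<^sub>2"
    by (metis strictly_positive_imp_blinfun_of)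
  have c': "0 \<le> c" "c \<le> 1"
    using c by auto
  define A where "A = c *\<^sub>R A\<^sub>1 + (1 - c) *\<^sub>R A\<^sub>2"
  define B where "B = c *\<^sub>R B\<^sub>1 + (1 - c) *\<^sub>R B\<^sub>2"
  have AB: "positive_invertible A" "positive_invertible B"
    unfolding A_def B_def using c' pos by (auto intro!: positive_invertible_combination)
  have "tsallis_power \<alpha> \<beta> A B - op_power A \<beta>
      \<le> c *\<^sub>R tsallis_power \<alpha> \<beta> A\<^sub>1 B\<^sub>1 + (1 - c) *\<^sub>R tsallis_power \<alpha> \<beta> A\<^sub>2 B\<^sub>2
        - (c *\<^sub>R op_power A\<^sub>1 \<beta> + (1 - c) *\<^sub>R op_power A\<^sub>2 \<beta>)"
    using assms c' pos AB
    by (intro diff_mono tsallis_power_convex op_power_concave) (auto simp: A_def B_def)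
  then have "(1 / \<alpha>) *\<^sub>R (tsallis_power \<alpha> \<beta> A B - op_power A \<beta>)
      \<le> (1 / \<alpha>) *\<^sub>R (c *\<^sub>R tsallis_power \<alpha> \<beta> A\<^sub>1 B\<^sub>1 + (1 - c) *\<^sub>R tsallis_power \<alpha> \<beta> A\<^sub>2 B\<^sub>2
        - (c *\<^sub>R op_power A\<^sub>1 \<beta> + (1 - c) *\<^sub>R op_power A\<^sub>2 \<beta>))"
    using assms(3) by (intro scaleR_left_mono) auto
  also have "\<dots> = c *\<^sub>R ((1 / \<alpha>) *\<^sub>R (tsallis_power \<alpha> \<beta> A\<^sub>1 B\<^sub>1 - op_power A\<^sub>1 \<beta>))
      + (1 - c) *\<^sub>R ((1 / \<alpha>) *\<^sub>R (tsallis_power \<alpha> \<beta> A\<^sub>2 B\<^sub>2 - op_power A\<^sub>2 \<beta>))"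
    by (rule scaleR_combination_diff)
  finally have "blinfun_of ((1 / \<alpha>) *\<^sub>R (tsallis_power \<alpha> \<beta> A B - op_power A \<beta>))
      \<le>\<^sub>o\<^sub>p blinfun_of (c *\<^sub>R ((1 / \<alpha>) *\<^sub>R (tsallis_power \<alpha> \<beta> A\<^sub>1 B\<^sub>1 - op_power A\<^sub>1 \<beta>))
      + (1 - c) *\<^sub>R ((1 / \<alpha>) *\<^sub>R (tsallis_power \<alpha> \<beta> A\<^sub>2 B\<^sub>2 - op_power A\<^sub>2 \<beta>)))"
    unfolding op_le_blinfun_of .
  then have "tsallis_entropy \<alpha> \<beta> (blinfun_of A) (blinfun_of B)
      \<le>\<^sub>o\<^sub>p c *\<^sub>R tsallis_entropy \<alpha> \<beta> (blinfun_of A\<^sub>1) (blinfun_of B\<^sub>1)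
        + (1 - c) *\<^sub>R tsallis_entropy \<alpha> \<beta> (blinfun_of A\<^sub>2) (blinfun_of B\<^sub>2)"
    using pos AB by (simp only: tsallis_entropy_blinfun_of blinfun_of_eqs(1,4))
  then show "tsallis_entropy \<alpha> \<beta> (c *\<^sub>R A1 + (1 - c) *\<^sub>R A2) (c *\<^sub>R B1 + (1 - c) *\<^sub>R B2)
      \<le>\<^sub>o\<^sub>p c *\<^sub>R tsallis_entropy \<alpha> \<beta> A1 B1 + (1 - c) *\<^sub>R tsallis_entropy \<alpha> \<beta> A2 B2"
    by (simp only: eqs A_def B_def blinfun_of_eqs(1,4))
qed

end
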